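(* Let $(x,v,\xi)$ be a global solution of the system (AMPD-DI) described in the context, with initial data $(x_0,v_0,\xi_0)$, and let $\bar x\in\Omega$ be arbitrary. Then, with the constants $\alpha_1(\bar x),\alpha_2(\bar x)$ and the function $C_0$ defined in the context, $$\|Ax(t)-b\|\le e^{-t}\,C_0\big(\alpha_1(\bar x),\,1+\alpha_2(\bar x)\big)\qquad\text{for all } t>0.$$
   Context: Setting. Let $m,n,r\ge 1$, $A\in\mathbb R^{r\times n}$ with $A\neq 0$, $b\in\mathbb R^r$, and assume $\Omega:=\{x\in\mathbb R^n: Ax=b\}\neq\emptyset$. For $1\le j\le m$ let $f_j:\mathbb R^n\to\mathbb R$ be a $C^1$ function whose gradient is $L_j$-Lipschitz and which satisfies $f_j(y)-f_j(x)-\langle\nabla f_j(x),y-x\rangle\ge\frac{\mu_j}{2}\|x-y\|^2$ for all $x,y$, where $0\le\mu_j\le L_j<\infty$ (so $f_j$ is convex, strongly convex if $\mu_j>0$). Put $\mu:=\min_j\mu_j$ and $L:=\max_j L_j$. Norms are Euclidean (operator norm for matrices), and $\sigma_{\min}^+(A)$ is the smallest nonzero singular value of $A$. Level-set assumption. For every $j$ and every $\alpha\in\mathbb R$, the level set $\mathcal L_{f_j}(\alpha)=\{x\in\mathbb R^n: f_j(x)\le\alpha\}$ is bounded. Put $R_j(\alpha):=\sup\{\|x\|:x\in\mathcal L_{f_j}(\alpha)\}$ and $R(\alpha):=\max_{1\le j\le m}R_j(\alpha)<\infty$. Dynamical system. Let $\theta_0,\gamma_0>0$ and let $\theta,\gamma:[0,\infty)\to\mathbb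 R$ solve $\theta'=-\theta$, $\theta(0)=\theta_0$ and $\gamma'=\mu-\gamma$, $\gamma(0)=\gamma_0$. Let $C(x):=\mathrm{conv}\{\nabla f_1(x),\dots,\nabla f_m(x)\}$. A global solution of (AMPD-DI) with initial data $x(0)=x_0\in\mathbb R^n$, $v(0)=v_0\in\mathbb R^n$, $\xi(0)=\xi_0\in\mathbb R^r$ is a triple $(x,v,\xi)\in C^1([0,\infty);\mathbb R^n)\times AC([0,\infty);\mathbb R^n)\times C^1([0,\infty);\mathbb R^r)$ ($AC$ = absolutely continuous) having these initial values and satisfying $$\theta\xi'=Av-b,\qquad x'=v-x,\qquad \gamma v'\in\mu(x-v)-A^\top\xi-\operatorname*{argmin}_{z\in C(x)}\langle x-v,z\rangle,$$ where the inclusion holds for almost every $t\ge 0$. Constants. For $s,t\ge0$, $$C_0(s,t):=\big(\max_j\|\nabla f_j(0)\|+Ls\big)(\|x_0\|+s)+L(\|x_0\|^2+s^2)+t\|Ax_0-b\|+\gamma_0(\|v_0\|^2+s^2)+\theta_0(\|\xi_0\|^2+t^2),$$ $$C_1(s):=\big(\max_j\|\nabla f_j(0)\|+L\|x_0\|\big)(\|x_0\|+s)+L(\|x_0\|^2+s^2).$$ For $\bar x\in\Omega$, $$\alpha_0(\bar x):=C_0(\|\bar x\|,0)+C_1(\|\bar x\|)+\max_j|f_j(x_0)|,$$ $$\alpha_1(\bar x):=\Big(1+\frac{\|A\|}{\sigma_{\min}^+(A)}\Big)R(\alpha_0(\bar x))+\frac{\|b\|}{\sigma_{\min}^+(A)},$$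 $$\alpha_2(\bar x):=\frac{L\,\alpha_1(\bar x)+\max_j\|\nabla f_j(0)\|}{\sigma_{\min}^+(A)}.$$ *)

theory Defs
  imports "HOL-Analysis.Analysis"
begin

definition grad :: "('a::real_inner \<Rightarrow> real) \<Rightarrow> 'a \<Rightarrow> 'a" where
  "grad f x = (THE D. GDERIV f x :> D)"

definition C1_fun :: "('a::real_inner \<Rightarrow> real) \<Rightarrow> bool" where
  "C1_fun f \<longleftrightarrow> (\<forall>x. f differentiable (at x)) \<and> continuous_on UNIV (grad f)"

definition C1_ray :: "(real \<Rightarrow> 'a::real_normed_vector) \<Rightarrow> bool" where
  "C1_ray u \<longleftrightarrow> (\<forall>t\<ge>0. u differentiable (at t within {0..})) \<and>
     continuous_on {0..} (\<lambda>t. vector_derivative u (at t within {0..}))"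

text \<open>The usual epsilon-delta notion for curves. It is unrelated to the library constant
  \<open>absolutely_continuous\<close>, which compares two measures.\<close>

definition abs_cont_on :: "real set \<Rightarrow> (real \<Rightarrow> 'a::real_normed_vector) \<Rightarrow> bool" where
  "abs_cont_on S u \<longleftrightarrow>
     (\<forall>\<epsilon>>0. \<exists>\<delta>>0. \<forall>(k::nat) (a::nat \<Rightarrow> real) c.
        (\<forall>i<k. a i \<le> c i \<and> {a i..c i} \<subseteq> S) \<longrightarrow>
        disjoint_family_on (\<lambda>i. {a i<..<c i}) {..<k} \<longrightarrow>
        (\<Sum>i<k. c i - a i) < \<delta> \<longrightarrow>
        (\<Sum>i<k. norm (u (c i) - u (a i))) < \<epsilon>)"

text \<open>On the unbounded ray, absolute continuity is required on every compact subinterval.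
  This is weaker than the epsilon-delta condition on the whole ray.\<close>

definition abs_cont_ray :: "(real \<Rightarrow> 'a::real_normed_vector) \<Rightarrow> bool" where
  "abs_cont_ray u \<longleftrightarrow> (\<forall>T>0. abs_cont_on {0..T} u)"

text \<open>Singular values are the square roots of the eigenvalues of the Gram matrix.
  Using \<open>transpose A ** A\<close> or \<open>A ** transpose A\<close> can only affect whether 0 is included.\<close>

definition singular_values :: "real ^ 'n ^ 'r \<Rightarrow> real set" where
  "singular_values A =
     {\<sigma>. \<sigma> \<ge> 0 \<and> (\<exists>u. u \<noteq> 0 \<and> (transpose A ** A) *v u = \<sigma>\<^sup>2 *\<^sub>R u)}"

definition sigma_min_pos :: "real ^ 'n ^ 'r \<Rightarrow> real" where
  "sigma_min_pos A = (LEAST \<sigma>. \<sigma> \<in> singular_values A \<and> \<sigma> \<noteq> 0)"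

definition level_set :: "('a \<Rightarrow> real) \<Rightarrow> real \<Rightarrow> 'a set" where
  "level_set f \<alpha> = {x. f x \<le> \<alpha>}"

text \<open>The supremum is unspecified for an empty level set. It is only evaluated at
  \<open>alpha0\<close>, which is at least \<open>f j x0\<close> for every \<open>j\<close>, so \<open>x0\<close> lies in every level set involved.\<close>

definition R_level :: "('m::finite \<Rightarrow> 'a::real_normed_vector \<Rightarrow> real) \<Rightarrow> real \<Rightarrow> real" where
  "R_level f \<alpha> = Max (range (\<lambda>j. Sup (norm ` level_set (f j) \<alpha>)))"

definition grad_hull :: "('m::finite \<Rightarrow> 'a::real_inner \<Rightarrow> real) \<Rightarrow> 'a \<Rightarrow> 'a set" where
  "grad_hull f x = convex hull (range (\<lambda>j. grad (f j) x))"

definition max_grad0 :: "('m::finite \<Rightarrow> 'a::real_inner \<Rightarrow> real) \<Rightarrow> real" where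
  "max_grad0 f = Max (range (\<lambda>j. norm (grad (f j) 0)))"

definition ampd_di_solution ::
  "real ^ 'n ^ 'r \<Rightarrow> real ^ 'r \<Rightarrow> ('m::finite \<Rightarrow> real ^ 'n \<Rightarrow> real) \<Rightarrow> real \<Rightarrow>
   (real \<Rightarrow> real) \<Rightarrow> (real \<Rightarrow> real) \<Rightarrow> real ^ 'n \<Rightarrow> real ^ 'n \<Rightarrow> real ^ 'r \<Rightarrow>
   (real \<Rightarrow> real ^ 'n) \<Rightarrow> (real \<Rightarrow> real ^ 'n) \<Rightarrow> (real \<Rightarrow> real ^ 'r) \<Rightarrow> bool" where
  "ampd_di_solution A b f \<mu> \<theta> \<gamma> x0 v0 \<xi>0 x v \<xi> \<longleftrightarrow>
     C1_ray x \<and> abs_cont_ray v \<and> C1_ray \<xi> \<and>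
     x 0 = x0 \<and> v 0 = v0 \<and> \<xi> 0 = \<xi>0 \<and>
     (\<forall>t\<ge>0. \<theta> t *\<^sub>R vector_derivative \<xi> (at t within {0..}) = A *v v t - b) \<and>
     (\<forall>t\<ge>0. vector_derivative x (at t within {0..}) = v t - x t) \<and>
     (AE t in lebesgue. t \<ge> 0 \<longrightarrow>
        v differentiable (at t within {0..}) \<and>
        \<gamma> t *\<^sub>R vector_derivative v (at t within {0..}) \<in>
          {\<mu> *\<^sub>R (x t - v t) - transpose A *v \<xi> t - z | z.
             is_arg_min (\<lambda>z. (x t - v t) \<bullet> z) (\<lambda>z. z \<in> grad_hull f (x t)) z})"

definition C0 ::
  "real ^ 'n ^ 'r \<Rightarrow> real ^ 'r \<Rightarrow> ('m::finite \<Rightarrow> real ^ 'n \<Rightarrow> real) \<Rightarrow> real \<Rightarrow> real \<Rightarrow> real \<Rightarrow>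
   real ^ 'n \<Rightarrow> real ^ 'n \<Rightarrow> real ^ 'r \<Rightarrow> real \<Rightarrow> real \<Rightarrow> real" where
  "C0 A b f L \<theta>0 \<gamma>0 x0 v0 \<xi>0 s t =
     (max_grad0 f + L * s) * (norm x0 + s) + L * ((norm x0)\<^sup>2 + s\<^sup>2)
     + t * norm (A *v x0 - b) + \<gamma>0 * ((norm v0)\<^sup>2 + s\<^sup>2) + \<theta>0 * ((norm \<xi>0)\<^sup>2 + t\<^sup>2)"

definition C1 :: "('m::finite \<Rightarrow> real ^ 'n \<Rightarrow> real) \<Rightarrow> real \<Rightarrow> real ^ 'n \<Rightarrow> real \<Rightarrow> real" where
  "C1 f L x0 s =
     (max_grad0 f + L * norm x0) * (norm x0 + s) + L * ((norm x0)\<^sup>2 + s\<^sup>2)"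

definition alpha0 ::
  "real ^ 'n ^ 'r \<Rightarrow> real ^ 'r \<Rightarrow> ('m::finite \<Rightarrow> real ^ 'n \<Rightarrow> real) \<Rightarrow> real \<Rightarrow> real \<Rightarrow> real \<Rightarrow>
   real ^ 'n \<Rightarrow> real ^ 'n \<Rightarrow> real ^ 'r \<Rightarrow> real ^ 'n \<Rightarrow> real" where
  "alpha0 A b f L \<theta>0 \<gamma>0 x0 v0 \<xi>0 xb =
     C0 A b f L \<theta>0 \<gamma>0 x0 v0 \<xi>0 (norm xb) 0 + C1 f L x0 (norm xb)
     + Max (range (\<lambda>j. \<bar>f j x0\<bar>))"

definition alpha1 ::
  "real ^ 'n ^ 'r \<Rightarrow> real ^ 'r \<Rightarrow> ('m::finite \<Rightarrow> real ^ 'n \<Rightarrow> real) \<Rightarrow> real \<Rightarrow> real \<Rightarrow> real \<Rightarrow>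
   real ^ 'n \<Rightarrow> real ^ 'n \<Rightarrow> real ^ 'r \<Rightarrow> real ^ 'n \<Rightarrow> real" where
  "alpha1 A b f L \<theta>0 \<gamma>0 x0 v0 \<xi>0 xb =
     (1 + onorm ((*v) A) / sigma_min_pos A) * R_level f (alpha0 A b f L \<theta>0 \<gamma>0 x0 v0 \<xi>0 xb)
     + norm b / sigma_min_pos A"

definition alpha2 ::
  "real ^ 'n ^ 'r \<Rightarrow> real ^ 'r \<Rightarrow> ('m::finite \<Rightarrow> real ^ 'n \<Rightarrow> real) \<Rightarrow> real \<Rightarrow> real \<Rightarrow> real \<Rightarrow>
   real ^ 'n \<Rightarrow> real ^ 'n \<Rightarrow> real ^ 'r \<Rightarrow> real ^ 'n \<Rightarrow> real" where
  "alpha2 A b f L \<theta>0 \<gamma>0 x0 v0 \<xi>0 xb =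
     (L * alpha1 A b f L \<theta>0 \<gamma>0 x0 v0 \<xi>0 xb + max_grad0 f) / sigma_min_pos A"

end

theory Submission
  imports Defs
begin

text \<open>For a feasible point \<open>xh\<close> and a multiplier \<open>\<zeta>\<close>, the energy
  \<open>E(t) = min\<^sub>j (f\<^sub>j(x) - f\<^sub>j(xh)) + \<langle>\<zeta>, Ax - b\<rangle> + \<gamma>/2 |v - xh|\<^sup>2 + \<theta>/2 |\<xi> - \<zeta>|\<^sup>2\<close>
  satisfies \<open>E' \<le> -E\<close> almost everywhere, so \<open>exp t * E t \<le> E 0\<close>. With \<open>xh = xb\<close> and \<open>\<zeta> = 0\<close> this confines
  the trajectory to a level set. Then, for fixed \<open>t\<close>, \<open>xh\<close> is taken to be a feasible point close to \<open>x t\<close>, and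
  \<open>\<zeta>\<close> a multiple of \<open>A x t - b\<close> whose pairing with \<open>A x t - b\<close> compensates the first-order lower bound of the
  minimum in \<open>E\<close> up to \<open>norm (A x t - b)\<close>; hence \<open>norm (A x t - b) \<le> E t\<close>.\<close>

section \<open>Monotonicity of absolutely continuous functions\<close>

text \<open>Enumerating \<open>B\<close> carries the condition, stated for families indexed by an
  initial segment of the naturals, over to any finite index set. It is applied to the tagged pieces
  of a gauge division.\<close>

lemma sum_abs_diff_less_abs_cont_on:
  fixes g :: "real \<Rightarrow> 'a::real_normed_vector"
  assumes \<delta>: "\<And>(k::nat) (a::nat \<Rightarrow> real) c.
      (\<forall>i<k. a i \<le> c i \<and> {a i..c i} \<subseteq> S) \<Longrightarrow>
      disjoint_family_on (\<lambda>i. {a i<..<c i}) {..<k} \<Longrightarrow>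
      (\<Sum>i<k. c i - a i) < \<delta> \<Longrightarrow> (\<Sum>i<k. norm (g (c i) - g (a i))) < \<epsilon>"
    and "finite B"
    and sub: "\<And>i. i \<in> B \<Longrightarrow> l i \<le> u i \<and> {l i..u i} \<subseteq> S"
    and disj: "disjoint_family_on (\<lambda>i. {l i<..<u i}) B"
    and len: "(\<Sum>i\<in>B. u i - l i) < \<delta>"
  shows "(\<Sum>i\<in>B. norm (g (u i) - g (l i))) < \<epsilon>"
proof -
  obtain h where h: "bij_betw h {..<card B} B"
    using ex_bij_betw_nat_finite[OF \<open>finite B\<close>] atLeast0LessThan by metis
  have hB: "h i \<in> B" if "i < card B" for i
    using bij_betwE[OF h] that by blast
  have "disjoint_family_on (\<lambda>i. {(l \<circ> h) i<..<(u \<circ> h) i}) {..<card B}"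
    unfolding disjoint_family_on_def comp_def
    using disj h hB unfolding disjoint_family_on_def bij_betw_def inj_on_def
    by (metis lessThan_iff)
  moreover have "(\<Sum>i<card B. (u \<circ> h) i - (l \<circ> h) i) = (\<Sum>i\<in>B. u i - l i)"
    using sum.reindex_bij_betw[OF h, of "\<lambda>i. u i - l i"] by simp
  moreover have "(\<Sum>i<card B. norm (g ((u \<circ> h) i) - g ((l \<circ> h) i))) = (\<Sum>i\<in>B. norm (g (u i) - g (l i)))"
    using sum.reindex_bij_betw[OF h, of "\<lambda>i. norm (g (u i) - g (l i))"] by simp
  ultimately show ?thesis
    using \<delta>[of "card B" "l \<circ> h" "u \<circ> h"] sub hB len by simp
qed

text \<open>Removing the null set \<open>N\<close> does not change the measure of an open superset,
  so a small excess \<open>U - N\<close> already means a small \<open>U\<close>.\<close>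

lemma negligible_outer_open:
  fixes N :: "'a::euclidean_space set"
  assumes "negligible N" "0 < e"
  obtains U where "open U" "N \<subseteq> U" "U \<in> lmeasurable" "measure lebesgue U < e"
proof -
  have N: "N \<in> null_sets lebesgue" "N \<in> sets lebesgue"
    using assms(1) by (auto simp: negligible_iff_null_sets)
  obtain U where U: "open U" "N \<subseteq> U" "U - N \<in> lmeasurable" "emeasure lebesgue (U - N) < ennreal e"
    using sets_lebesgue_outer_open[OF N(2) assms(2)] by blast
  have "U \<in> sets lebesgue" using U(1) by (simp add: borel_open)
  then have "emeasure lebesgue (U - N) = emeasure lebesgue U"
    by (rule emeasure_Diff_null_set[OF N(1)])
  with U(4) have less: "emeasure lebesgue U < ennreal e" by simp
  with \<open>U \<in> sets lebesgue\<close> have "U \<in> lmeasurable"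
    by (intro fmeasurableI) (auto intro: order.strict_trans ennreal_less_top)
  moreover have "measure lebesgue U < e"
    using less emeasure_eq_measure2[OF calculation] assms(2) by (simp add: ennreal_less_iff)
  ultimately show thesis using that U by blast
qed

text \<open>A gauge argument: tags outside \<open>N\<close> are handled by the slope bound, while the intervals with
  tags in \<open>N\<close> lie in an open set of small measure, where absolute continuity applies.\<close>

lemma abs_cont_on_nonincreasing:
  fixes g :: "real \<Rightarrow> real"
  assumes "a \<le> b" and ac: "abs_cont_on {a..b} g" and "negligible N"
    and slope: "\<And>t e. t \<in> {a..b} - N \<Longrightarrow> 0 < e \<Longrightarrow>
      \<exists>d>0. \<forall>r\<in>{a..b}. \<forall>s\<in>{a..b}. t - d < r \<and> r \<le> t \<and> t \<le> s \<and> s < t + d \<longrightarrow> g s - g r \<le> e * (s - r)"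
  shows "g b \<le> g a"
proof -
  \<comment> \<open>One \<open>e\<close> serves twice: as the slope allowed on pieces tagged outside
    \<open>N\<close>, giving \<open>e * (b - a)\<close>, and as the total variation allowed on
    pieces tagged in \<open>N\<close>, giving the last \<open>e\<close>.\<close>
  have main: "g b - g a \<le> e * (b - a) + e" if "0 < e" for e
  proof -
    obtain \<delta> where "\<delta> > 0" and \<delta>: "\<And>(k::nat) (l::nat \<Rightarrow> real) u.
      (\<forall>i<k. l i \<le> u i \<and> {l i..u i} \<subseteq> {a..b}) \<Longrightarrow>
      disjoint_family_on (\<lambda>i. {l i<..<u i}) {..<k} \<Longrightarrow>
      (\<Sum>i<k. u i - l i) < \<delta> \<Longrightarrow> (\<Sum>i<k. norm (g (u i) - g (l i))) < e"
      using ac \<open>0 < e\<close> unfolding abs_cont_on_def by blast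
    obtain U where U: "open U" "N \<subseteq> U" "U \<in> lmeasurable" "measure lebesgue U < \<delta>"
      using negligible_outer_open[OF assms(3) \<open>\<delta> > 0\<close>] .
    have "\<exists>d>0. (t \<in> N \<longrightarrow> ball t d \<subseteq> U) \<and> (t \<in> {a..b} - N \<longrightarrow>
      (\<forall>r\<in>{a..b}. \<forall>s\<in>{a..b}. t - d < r \<and> r \<le> t \<and> t \<le> s \<and> s < t + d \<longrightarrow> g s - g r \<le> e * (s - r)))" for t
    proof (cases "t \<in> N")
      case True
      then show ?thesis using U(1,2) by (auto simp: open_contains_ball)
    next
      case False
      then show ?thesis using slope[of t e] \<open>0 < e\<close>
        by (cases "t \<in> {a..b}") (auto intro: zero_less_one)
    qed
    then obtain d where d: "\<And>t. 0 < d t" "\<And>t. t \<in> N \<Longrightarrow> ball t (d t) \<subseteq> U"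
      "\<And>t r s. t \<in> {a..b} - N \<Longrightarrow> r \<in> {a..b} \<Longrightarrow> s \<in> {a..b} \<Longrightarrow> t - d t < r \<Longrightarrow> r \<le> t \<Longrightarrow> t \<le> s
        \<Longrightarrow> s < t + d t \<Longrightarrow> g s - g r \<le> e * (s - r)"
      by metis
    obtain p where p: "p tagged_division_of {a..b}" "(\<lambda>t. ball t (d t)) fine p"
      using fine_division_exists_real[OF gauge_ball_dependent] d(1) by blast
    have K: "K = {Inf K..Sup K} \<and> Inf K \<le> x \<and> x \<le> Sup K \<and> K \<subseteq> {a..b} \<and> K \<subseteq> ball x (d x)"
      if xK: "(x, K) \<in> p" for x K
    proof -
      obtain l u where lu: "K = {l..u}"
        using tagged_division_ofD(4)[OF p(1) xK] by auto
      moreover have "x \<in> K" using tagged_division_ofD(2)[OF p(1) xK] .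
      moreover have "K \<subseteq> {a..b}" using tagged_division_ofD(3)[OF p(1) xK] .
      ultimately show ?thesis using fineD[OF p(2) xK] by auto
    qed
    define B where "B = {q \<in> p. fst q \<in> N}"
    have fin: "finite p" "B \<subseteq> p" using tagged_division_ofD(1)[OF p(1)] by (auto simp: B_def)
    have finB: "finite B" using finite_subset[OF fin(2,1)] .
    have good: "(\<Sum>(x,K)\<in>p - B. g (Sup K) - g (Inf K)) \<le> e * (b - a)"
    proof -
      have "(\<Sum>(x,K)\<in>p - B. g (Sup K) - g (Inf K)) \<le> (\<Sum>(x,K)\<in>p - B. e * (Sup K - Inf K))"
      proof (rule sum_mono, clarify)
        fix x K assume xK: "(x, K) \<in> p" "(x, K) \<notin> B"
        note k = K[OF xK(1)]
        have mem: "Inf K \<in> K" "Sup K \<in> K" "x \<in> K" using k by (metis atLeastAtMost_iff order_trans order_refl)+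
        with k have "Inf K \<in> ball x (d x)" "Sup K \<in> ball x (d x)" "Inf K \<in> {a..b}" "Sup K \<in> {a..b}" "x \<in> {a..b}"
          by blast+
        then show "g (Sup K) - g (Inf K) \<le> e * (Sup K - Inf K)"
          using k xK by (intro d(3)[of x]) (auto simp: B_def dist_real_def)
      qed
      \<comment> \<open>Lengths are nonnegative, so the pieces of \<open>B\<close> may be added
        back; the full sum of lengths then telescopes to \<open>b - a\<close>.\<close>
      also have "\<dots> \<le> (\<Sum>(x,K)\<in>p. e * (Sup K - Inf K))"
        using fin K \<open>0 < e\<close> by (intro sum_mono2) (force intro!: mult_nonneg_nonneg)+
      also have "\<dots> = e * (\<Sum>(x,K)\<in>p. Sup K - Inf K)"
        by (simp add: sum_distrib_left case_prod_unfold)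
      also have "\<dots> = e * (b - a)"
        using additive_tagged_division_1[OF \<open>a \<le> b\<close> p(1), of "\<lambda>x. x"] by simp
      finally show ?thesis .
    qed
    have bad: "(\<Sum>(x,K)\<in>B. g (Sup K) - g (Inf K)) \<le> e"
    proof -
      have disj: "disjoint_family_on (\<lambda>q. {Inf (snd q)<..<Sup (snd q)}) B"
        unfolding disjoint_family_on_def
      proof (intro ballI impI)
        fix q q' assume q: "q \<in> B" "q' \<in> B" "q \<noteq> q'"
        have "interior (snd q) \<inter> interior (snd q') = {}"
          using tagged_division_ofD(5)[OF p(1), of "fst q" "snd q" "fst q'" "snd q'"] q
          by (auto simp: B_def)
        moreover have "interior (snd s) = {Inf (snd s)<..<Sup (snd s)}" if "s \<in> B" for s
        proof -
          have "(fst s, snd s) \<in> p" using that by (simp add: B_def)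
          then have "snd s = {Inf (snd s)..Sup (snd s)}" using K by blast
          then have "interior (snd s) = interior {Inf (snd s)..Sup (snd s)}" by (rule arg_cong)
          then show ?thesis by (simp only: interior_atLeastAtMost_real)
        qed
        ultimately show "{Inf (snd q)<..<Sup (snd q)} \<inter> {Inf (snd q')<..<Sup (snd q')} = {}"
          using q by simp
      qed
      have sub: "Inf (snd q) \<le> Sup (snd q) \<and> {Inf (snd q)..Sup (snd q)} \<subseteq> {a..b}"
        and sub_U: "{Inf (snd q)<..<Sup (snd q)} \<subseteq> U" if "q \<in> B" for q
      proof -
        have *: "(fst q, snd q) \<in> p" "fst q \<in> N" using that by (auto simp: B_def)
        have eq: "snd q = {Inf (snd q)..Sup (snd q)}" using K[OF *(1)] by (elim conjE)
        have le: "Inf (snd q) \<le> Sup (snd q)" using K[OF *(1)] by linarith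
        have "snd q \<subseteq> {a..b}" "snd q \<subseteq> ball (fst q) (d (fst q))" using K[OF *(1)] by blast+
        then have "{Inf (snd q)..Sup (snd q)} \<subseteq> {a..b}" "{Inf (snd q)..Sup (snd q)} \<subseteq> U"
          using d(2)[OF *(2)] unfolding eq[symmetric] by blast+
        moreover have "{Inf (snd q)<..<Sup (snd q)} \<subseteq> {Inf (snd q)..Sup (snd q)}" by auto
        ultimately show "Inf (snd q) \<le> Sup (snd q) \<and> {Inf (snd q)..Sup (snd q)} \<subseteq> {a..b}"
          "{Inf (snd q)<..<Sup (snd q)} \<subseteq> U" using le by blast+
      qed
      \<comment> \<open>The open interiors are disjoint and lie in \<open>U\<close>, so their total
        length is a measure bounded by that of \<open>U\<close>, which is below
        \<open>\<delta>\<close>.\<close>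
      have "(\<Sum>q\<in>B. Sup (snd q) - Inf (snd q)) = (\<Sum>q\<in>B. measure lebesgue {Inf (snd q)<..<Sup (snd q)})"
        using sub by (intro sum.cong) auto
      also have "\<dots> = measure lebesgue (\<Union>q\<in>B. {Inf (snd q)<..<Sup (snd q)})"
        using finB disj by (intro measure_UNION'[symmetric])
          (auto simp: pairwise_def disjnt_def disjoint_family_on_def)
      also have "\<dots> \<le> measure lebesgue U"
        using sub_U finB U by (intro measure_mono_fmeasurable) auto
      finally have "(\<Sum>q\<in>B. Sup (snd q) - Inf (snd q)) < \<delta>" using U(4) by simp
      from sum_abs_diff_less_abs_cont_on[where g = g and S = "{a..b}", OF \<delta> finB sub disj this]
      have "(\<Sum>q\<in>B. norm (g (Sup (snd q)) - g (Inf (snd q)))) < e" by blast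
      moreover have "(\<Sum>q\<in>B. g (Sup (snd q)) - g (Inf (snd q))) \<le> (\<Sum>q\<in>B. norm (g (Sup (snd q)) - g (Inf (snd q))))"
        by (intro sum_mono) simp
      ultimately show ?thesis by (simp add: case_prod_unfold)
    qed
    have "g b - g a = (\<Sum>(x,K)\<in>p. g (Sup K) - g (Inf K))"
      using additive_tagged_division_1[OF \<open>a \<le> b\<close> p(1), of g] by simp
    also have "\<dots> = (\<Sum>(x,K)\<in>p - B. g (Sup K) - g (Inf K)) + (\<Sum>(x,K)\<in>B. g (Sup K) - g (Inf K))"
      by (rule sum.subset_diff[OF fin(2,1)])
    finally show ?thesis using good bad by linarith
  qed
  have "g b - g a \<le> 0"
  proof (rule field_le_epsilon)
    fix e :: real assume "0 < e"
    \<comment> \<open>The scaling makes the two contributions in \<open>main\<close> add up to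
      exactly \<open>e\<close>.\<close>
    have "e / (b - a + 1) * (b - a) + e / (b - a + 1) = e / (b - a + 1) * (b - a + 1)"
      by (simp only: distrib_left mult_1_right)
    also have "\<dots> = e" using \<open>a \<le> b\<close> by simp
    finally show "g b - g a \<le> 0 + e"
      using main[of "e / (b - a + 1)"] \<open>a \<le> b\<close> \<open>0 < e\<close> by simp
  qed
  then show ?thesis by simp
qed

text \<open>The variation of \<open>g\<close> over a family of intervals is at most \<open>K\<close>
  times the total length plus the variation of \<open>v\<close>, and both become small
  together.\<close>

lemma abs_cont_on_dominated:
  fixes g :: "real \<Rightarrow> 'a::real_normed_vector" and v :: "real \<Rightarrow> 'b::real_normed_vector"
  assumes v: "abs_cont_on S v" and "0 \<le> K"
    and dom: "\<And>r s. r \<in> S \<Longrightarrow> s \<in> S \<Longrightarrow> r \<le> s \<Longrightarrow> norm (g s - g r) \<le> K * ((s - r) + norm (v s - v r))"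
  shows "abs_cont_on S g"
  unfolding abs_cont_on_def
proof (intro allI impI)
  fix \<epsilon> :: real assume "\<epsilon> > 0"
  \<comment> \<open>Half of the budget goes to the lengths and half to \<open>v\<close>. The
    denominator uses \<open>K + 1\<close> so that the final inequality is strict even for
    \<open>K = 0\<close>.\<close>
  define \<eta> where "\<eta> = \<epsilon> / (2 * (K + 1))"
  have "\<eta> > 0" using \<open>\<epsilon> > 0\<close> \<open>0 \<le> K\<close> by (simp add: \<eta>_def)
  then obtain \<delta> where \<delta>: "\<delta> > 0" "\<forall>(k::nat) (a::nat \<Rightarrow> real) c.
        (\<forall>i<k. a i \<le> c i \<and> {a i..c i} \<subseteq> S) \<longrightarrow> disjoint_family_on (\<lambda>i. {a i<..<c i}) {..<k} \<longrightarrow>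
        (\<Sum>i<k. c i - a i) < \<delta> \<longrightarrow> (\<Sum>i<k. norm (v (c i) - v (a i))) < \<eta>"
    using v unfolding abs_cont_on_def by meson
  show "\<exists>\<delta>>0. \<forall>(k::nat) (a::nat \<Rightarrow> real) c.
        (\<forall>i<k. a i \<le> c i \<and> {a i..c i} \<subseteq> S) \<longrightarrow> disjoint_family_on (\<lambda>i. {a i<..<c i}) {..<k} \<longrightarrow>
        (\<Sum>i<k. c i - a i) < \<delta> \<longrightarrow> (\<Sum>i<k. norm (g (c i) - g (a i))) < \<epsilon>"
  proof (intro exI[of _ "min \<delta> \<eta>"] conjI allI impI)
    fix k :: nat and a c :: "nat \<Rightarrow> real"
    assume ac: "\<forall>i<k. a i \<le> c i \<and> {a i..c i} \<subseteq> S" "disjoint_family_on (\<lambda>i. {a i<..<c i}) {..<k}"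
      and len: "(\<Sum>i<k. c i - a i) < min \<delta> \<eta>"
    have "(\<Sum>i<k. norm (g (c i) - g (a i))) \<le> (\<Sum>i<k. K * ((c i - a i) + norm (v (c i) - v (a i))))"
      using ac(1) by (intro sum_mono dom) (auto simp: subset_iff)
    also have "\<dots> = K * ((\<Sum>i<k. c i - a i) + (\<Sum>i<k. norm (v (c i) - v (a i))))"
      by (simp add: sum_distrib_left sum.distrib distrib_left)
    also have "\<dots> \<le> K * (\<eta> + \<eta>)"
      using \<delta>(2)[rule_format, of k a c] ac len \<open>0 \<le> K\<close> by (intro mult_left_mono add_mono) auto
    also have "\<dots> < (K + 1) * (\<eta> + \<eta>)"
      using \<open>\<eta> > 0\<close> by (intro mult_strict_right_mono) auto
    also have "\<dots> = \<epsilon>"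
      using \<open>0 \<le> K\<close> by (simp add: \<eta>_def divide_simps)
    finally show "(\<Sum>i<k. norm (g (c i) - g (a i))) < \<epsilon>" .
  qed (use \<delta> \<open>\<eta> > 0\<close> in auto)
qed

section \<open>Pointwise minima of finite families\<close>

lemma Min_range_in:
  fixes h :: "'m::finite \<Rightarrow> real"
  obtains j where "h j = Min (range h)"
proof -
  have "Min (range h) \<in> range h" by (rule Min_in) auto
  then obtain j where "Min (range h) = h j" by (rule rangeE)
  then show thesis by (rule that[OF sym])
qed

lemma Min_range_le: "Min (range h) \<le> (h j :: real)" for h :: "'m::finite \<Rightarrow> real"
  by simp

text \<open>An index that is not minimal at \<open>t\<close> stays above a minimal one nearby, so an
  index minimal at the left end \<open>r\<close> is minimal at \<open>t\<close> too. Its increment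
  from \<open>r\<close> to \<open>s\<close> bounds that of the minimum, and its slope at
  \<open>t\<close> is nonpositive. The minimum itself need not be differentiable; intervals
  straddling \<open>t\<close> are what a tagged division supplies.\<close>

lemma Min_upper_slope:
  fixes h :: "'m::finite \<Rightarrow> real \<Rightarrow> real"
  assumes der: "\<And>j. (h j has_real_derivative h' j) (at t within S)"
    and active: "\<And>j. h j t = Min (range (\<lambda>i. h i t)) \<Longrightarrow> h' j \<le> 0"
    and "0 < e"
  shows "\<exists>d>0. \<forall>r\<in>S. \<forall>s\<in>S. t - d < r \<and> r \<le> t \<and> t \<le> s \<and> s < t + d \<longrightarrow>
    Min (range (\<lambda>i. h i s)) - Min (range (\<lambda>i. h i r)) \<le> e * (s - r)"
proof -
  define m where "m = Min (range (\<lambda>i. h i t))"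
  obtain i0 where i0: "h i0 t = m" using Min_range_in[of "\<lambda>i. h i t"] unfolding m_def by metis
  have ev: "\<forall>\<^sub>F y in at t within S. \<bar>h j y - h j t - h' j * (y - t)\<bar> \<le> e * \<bar>y - t\<bar> \<and>
      (h j t \<noteq> m \<longrightarrow> h i0 y < h j y)" for j
  proof (intro eventually_conj)
    have "((\<lambda>y. (h j y - h j t) / (y - t)) \<longlongrightarrow> h' j) (at t within S)"
      using der[of j] by (simp add: has_field_derivative_iff)
    then have "\<forall>\<^sub>F y in at t within S. dist ((h j y - h j t) / (y - t)) (h' j) < e"
      using \<open>0 < e\<close> by (rule tendstoD)
    then show "\<forall>\<^sub>F y in at t within S. \<bar>h j y - h j t - h' j * (y - t)\<bar> \<le> e * \<bar>y - t\<bar>"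
    proof (rule eventually_mono[OF eventually_conj[OF _ eventually_neq_at_within[of t t S]]])
      fix y assume y: "dist ((h j y - h j t) / (y - t)) (h' j) < e \<and> y \<noteq> t"
      then have "h j y - h j t - h' j * (y - t) = ((h j y - h j t) / (y - t) - h' j) * (y - t)"
        by (simp only: left_diff_distrib) simp
      then have "\<bar>h j y - h j t - h' j * (y - t)\<bar> = dist ((h j y - h j t) / (y - t)) (h' j) * \<bar>y - t\<bar>"
        by (simp only: dist_real_def abs_mult)
      with y show "\<bar>h j y - h j t - h' j * (y - t)\<bar> \<le> e * \<bar>y - t\<bar>"
        by (simp add: mult_right_mono)
    qed
    have "((\<lambda>y. h j y - h i0 y) \<longlongrightarrow> h j t - h i0 t) (at t within S)"
      using DERIV_continuous[OF der[of j]] DERIV_continuous[OF der[of i0]]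
      by (intro tendsto_diff) (auto simp: continuous_within)
    moreover have "m \<le> h j t" unfolding m_def by (rule Min_range_le)
    ultimately show "\<forall>\<^sub>F y in at t within S. h j t \<noteq> m \<longrightarrow> h i0 y < h j y"
      using order_tendstoD(1)[of "\<lambda>y. h j y - h i0 y" "h j t - h i0 t" _ 0] i0
      by (cases "h j t = m") auto
  qed
  have "\<forall>\<^sub>F y in at t within S. \<forall>j. \<bar>h j y - h j t - h' j * (y - t)\<bar> \<le> e * \<bar>y - t\<bar> \<and>
      (h j t \<noteq> m \<longrightarrow> h i0 y < h j y)"
    using ev by (rule eventually_all_finite)
  then obtain d where d: "d > 0" "\<And>y j. y \<in> S \<Longrightarrow> y \<noteq> t \<Longrightarrow> dist y t < d \<Longrightarrow>
      \<bar>h j y - h j t - h' j * (y - t)\<bar> \<le> e * \<bar>y - t\<bar> \<and> (h j t \<noteq> m \<longrightarrow> h i0 y < h j y)"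
    unfolding eventually_at by metis
  have near: "\<bar>h j y - h j t - h' j * (y - t)\<bar> \<le> e * \<bar>y - t\<bar> \<and> (h j t \<noteq> m \<longrightarrow> h i0 y < h j y)"
    if "y \<in> S" "dist y t < d" for y j
  proof (cases "y = t")
    case True
    moreover have "m \<le> h j t" unfolding m_def by (rule Min_range_le)
    ultimately show ?thesis using i0 by auto
  qed (use d(2) that in auto)
  show ?thesis
  proof (intro exI[of _ d] conjI ballI impI d(1))
    fix r s assume rs: "r \<in> S" "s \<in> S" "t - d < r \<and> r \<le> t \<and> t \<le> s \<and> s < t + d"
    then have D: "dist r t < d" "dist s t < d" by (auto simp: dist_real_def)
    obtain j where j: "h j r = Min (range (\<lambda>i. h i r))" using Min_range_in[of "\<lambda>i. h i r"] .
    have "h j r \<le> h i0 r" unfolding j by (rule Min_range_le)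
    then have "h j t = m" using near[OF rs(1) D(1), of j] by auto
    then have "h' j \<le> 0" using active by (simp add: m_def)
    then have "h' j * (s - r) \<le> 0" using rs by (intro mult_nonpos_nonneg) auto
    moreover have "\<bar>h j s - h j t - h' j * (s - t)\<bar> \<le> e * (s - t)" "\<bar>h j r - h j t - h' j * (r - t)\<bar> \<le> e * (t - r)"
      using near[OF rs(2) D(2), of j] near[OF rs(1) D(1), of j] rs(3) by auto
    moreover have "Min (range (\<lambda>i. h i s)) \<le> h j s" by (rule Min_range_le)
    ultimately show "Min (range (\<lambda>i. h i s)) - Min (range (\<lambda>i. h i r)) \<le> e * (s - r)"
    proof -
      have "h' j * (s - t) - h' j * (r - t) = h' j * (s - r)" "e * (s - t) + e * (t - r) = e * (s - r)"
        by (simp_all add: algebra_simps)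
      then show ?thesis using j \<open>h' j * (s - r) \<le> 0\<close>
          \<open>\<bar>h j s - h j t - h' j * (s - t)\<bar> \<le> e * (s - t)\<close> \<open>\<bar>h j r - h j t - h' j * (r - t)\<bar> \<le> e * (t - r)\<close>
          \<open>Min (range (\<lambda>i. h i s)) \<le> h j s\<close> by linarith
    qed
  qed
qed

lemma Min_range_diff_le:
  fixes p q :: "'m::finite \<Rightarrow> real"
  assumes "\<And>j. p j - q j \<le> c"
  shows "Min (range p) - Min (range q) \<le> c"
proof -
  obtain j where "q j = Min (range q)" using Min_range_in .
  then show ?thesis using assms[of j] Min_range_le[of p j] by linarith
qed

section \<open>Existence and uniqueness of gradients\<close>

lemma GDERIV_unique:
  assumes "GDERIV f x :> D" "GDERIV f x :> E"
  shows "D = E"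
proof -
  have "(\<lambda>h. h \<bullet> D) = (\<lambda>h. h \<bullet> E)"
    using assms unfolding gderiv_def by (rule has_derivative_unique)
  then have "(D - E) \<bullet> (D - E) = 0" by (metis inner_diff_right right_minus_eq)
  then show ?thesis by simp
qed

lemma GDERIV_grad:
  fixes f :: "'a::euclidean_space \<Rightarrow> real"
  assumes "f differentiable (at x)"
  shows "GDERIV f x :> grad f x"
proof -
  obtain f' where f': "(f has_derivative f') (at x)"
    using assms by (auto simp: differentiable_def)
  then interpret bounded_linear f' by (rule has_derivative_bounded_linear)
  define D where "D = (\<Sum>i\<in>Basis. f' i *\<^sub>R i)"
  have "f' h = h \<bullet> D" for h
  proof -
    have "f' h = f' (\<Sum>i\<in>Basis. (h \<bullet> i) *\<^sub>R i)" by (simp add: euclidean_representation)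
    also have "\<dots> = h \<bullet> D" by (simp add: sum scaleR D_def inner_sum_right mult.commute)
    finally show ?thesis .
  qed
  then have "f' = (\<lambda>h. h \<bullet> D)" by blast
  with f' have "GDERIV f x :> D" by (simp add: gderiv_def)
  then show ?thesis unfolding grad_def by (metis GDERIV_unique the_equality)
qed

section \<open>The smallest nonzero singular value and distance to the feasible set\<close>

text \<open>For small \<open>s\<close> of sign opposite to \<open>\<beta>\<close> the linear term
  dominates. This is the first-order optimality condition for the Rayleigh quotient below.\<close>

lemma quadratic_nonneg_imp_linear_zero:
  fixes \<beta> \<kappa> :: real
  assumes "\<And>s. 0 \<le> 2 * s * \<beta> + s\<^sup>2 * \<kappa>"
  shows "\<beta> = 0"
proof (rule ccontr)
  assume "\<beta> \<noteq> 0"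
  define s where "s = - \<beta> / (\<bar>\<kappa>\<bar> + 1)"
  \<comment> \<open>The square factor clears the denominator of \<open>s\<close>.\<close>
  have "0 \<le> (2 * s * \<beta> + s\<^sup>2 * \<kappa>) * (\<bar>\<kappa>\<bar> + 1)\<^sup>2"
    using assms by (intro mult_nonneg_nonneg) auto
  also have "\<dots> = \<beta>\<^sup>2 * (\<kappa> - 2 * (\<bar>\<kappa>\<bar> + 1))"
  proof -
    have "s * (\<bar>\<kappa>\<bar> + 1) = - \<beta>" by (simp add: s_def)
    moreover have "(2 * s * \<beta> + s\<^sup>2 * \<kappa>) * (\<bar>\<kappa>\<bar> + 1)\<^sup>2 =
        2 * \<beta> * (s * (\<bar>\<kappa>\<bar> + 1)) * (\<bar>\<kappa>\<bar> + 1) + (s * (\<bar>\<kappa>\<bar> + 1))\<^sup>2 * \<kappa>"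
      by (simp add: algebra_simps power2_eq_square)
    ultimately show ?thesis by (simp add: algebra_simps power2_eq_square)
  qed
  also have "\<dots> < 0" using \<open>\<beta> \<noteq> 0\<close> by (intro mult_pos_neg) auto
  finally show False by simp
qed

text \<open>The orthogonal complement of the kernel, that is, the row space of
  \<open>A\<close>.\<close>

abbreviation ker_perp :: "real ^ 'n ^ 'r \<Rightarrow> (real ^ 'n) set" where
  "ker_perp A \<equiv> {u. \<forall>k. A *v k = 0 \<longrightarrow> orthogonal k u}"

lemma transpose_inner: "(transpose A *v y) \<bullet> x = y \<bullet> (A *v x)" for A :: "real ^ 'n ^ 'r"
  by (simp add: dot_lmul_matrix)

lemma transpose_mult_in_ker_perp: "transpose A *v y \<in> ker_perp A" for A :: "real ^ 'n ^ 'r"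
  using transpose_inner[of A y] by (simp add: orthogonal_def inner_commute)

lemma ker_perp_decomp:
  fixes A :: "real ^ 'n ^ 'r"
  obtains k u where "A *v k = 0" "u \<in> ker_perp A" "x = k + u"
proof -
  define S where "S = {k. A *v k = 0}"
  have "subspace S" unfolding S_def
    by (simp add: subspace_def matrix_vector_right_distrib matrix_vector_mult_scaleR)
  then have "span S = S" by (simp add: span_eq_iff)
  obtain k u where "k \<in> span S" "\<And>w. w \<in> span S \<Longrightarrow> orthogonal u w" "x = k + u"
    using orthogonal_subspace_decomp_exists[of S x] by blast
  moreover from this have "k \<in> S" "\<And>w. w \<in> S \<Longrightarrow> orthogonal w u"
    using \<open>span S = S\<close> by (auto simp: orthogonal_commute)
  ultimately show thesis by (intro that[of k u]) (auto simp: S_def)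
qed

text \<open>The minimum of the Rayleigh quotient on \<open>ker_perp A\<close> is the square of the least nonzero singular value.\<close>

lemma sigma_min_pos_properties:
  fixes A :: "real ^ 'n ^ 'r"
  assumes "A \<noteq> 0"
  shows "0 < sigma_min_pos A \<and> (\<forall>u\<in>ker_perp A. sigma_min_pos A * norm u \<le> norm (A *v u))"
proof -
  define K where "K = sphere 0 1 \<inter> ker_perp A"
  have perp: "subspace (ker_perp A)"
    using subspace_orthogonal_to_vectors[of "{k. A *v k = 0}"] by (simp add: orthogonal_commute)
  have "compact K" unfolding K_def
    by (intro compact_Int_closed closed_subspace perp) auto
  have zero: "u = 0" if "u \<in> ker_perp A" "A *v u = 0" for u
    using that by (auto simp: orthogonal_def)
  obtain y where y: "A *v y \<noteq> 0"
    using assms by (metis matrix_eq matrix_vector_mult_0)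
  \<comment> \<open>A nonzero element of \<open>ker_perp A\<close>, because its inner product with
    \<open>y\<close> is the squared norm of \<open>A *v y\<close>. Normalized, it shows that
    \<open>K\<close> is nonempty.\<close>
  define w where "w = transpose A *v (A *v y)"
  have "w \<noteq> 0" using transpose_inner[of A "A *v y" y] y by (auto simp: w_def)
  have "w \<in> ker_perp A" unfolding w_def by (rule transpose_mult_in_ker_perp)
  then have "w /\<^sub>R norm w \<in> K"
    using \<open>w \<noteq> 0\<close> perp by (simp add: K_def orthogonal_def)
  then have "K \<noteq> {}" by blast
  have "continuous_on K (\<lambda>u. norm (A *v u))"
    by (intro continuous_intros matrix_vector_mult_linear_continuous_on)
  then obtain u0 where u0: "u0 \<in> K" "\<And>u. u \<in> K \<Longrightarrow> norm (A *v u0) \<le> norm (A *v u)"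
    using continuous_attains_inf[OF \<open>compact K\<close> \<open>K \<noteq> {}\<close>] by blast
  define c where "c = norm (A *v u0)"
  have u0': "norm u0 = 1" "u0 \<in> ker_perp A" "u0 \<noteq> 0" using u0(1) by (auto simp: K_def)
  have "c > 0" using zero u0' by (auto simp: c_def)
  have low: "c * norm u \<le> norm (A *v u)" if u: "u \<in> ker_perp A" for u
  proof (cases "u = 0")
    case False
    then have "u /\<^sub>R norm u \<in> K" using u by (simp add: K_def orthogonal_def)
    from u0(2)[OF this] have "c \<le> norm (A *v u) / norm u"
      by (simp add: c_def matrix_vector_mult_scaleR divide_inverse_commute)
    then show ?thesis using False by (simp add: field_simps)
  qed simp
  have eig: "(transpose A ** A) *v u0 = c\<^sup>2 *\<^sub>R u0"
  proof -
    \<comment> \<open>The eigenvalue defect of the minimizer is itself an admissible direction.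
      Along \<open>u0 + s *\<^sub>R e\<close> the bound \<open>low\<close> is an equality at
      \<open>s = 0\<close>, and its linear coefficient is twice \<open>e \<bullet> e\<close>, which
      must therefore vanish.\<close>
    define e where "e = transpose A *v (A *v u0) - c\<^sup>2 *\<^sub>R u0"
    have e: "e \<in> ker_perp A" unfolding e_def
      using transpose_mult_in_ker_perp[of A "A *v u0"] u0'(2) perp
      by (intro subspace_diff subspace_scale) auto
    have "0 \<le> 2 * s * (e \<bullet> e) + s\<^sup>2 * ((norm (A *v e))\<^sup>2 - c\<^sup>2 * (norm e)\<^sup>2)" for s
    proof -
      have "u0 + s *\<^sub>R e \<in> ker_perp A"
        using e u0'(2) perp by (intro subspace_add subspace_scale) auto
      then have "(c * norm (u0 + s *\<^sub>R e))\<^sup>2 \<le> (norm (A *v (u0 + s *\<^sub>R e)))\<^sup>2"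
        using low \<open>c > 0\<close> by (intro power_mono) auto
      moreover have "(norm (u0 + s *\<^sub>R e))\<^sup>2 = 1 + 2 * s * (u0 \<bullet> e) + s\<^sup>2 * (norm e)\<^sup>2"
        using u0'(1) by (simp add: power2_norm_eq_inner norm_eq_1 inner_add inner_commute[of e u0])
          (simp add: power2_eq_square algebra_simps)
      moreover have "(norm (A *v (u0 + s *\<^sub>R e)))\<^sup>2 = c\<^sup>2 + 2 * s * ((A *v u0) \<bullet> (A *v e)) + s\<^sup>2 * (norm (A *v e))\<^sup>2"
        unfolding c_def power2_norm_eq_inner matrix_vector_right_distrib matrix_vector_mult_scaleR
          inner_add inner_scaleR_left inner_scaleR_right inner_commute[of "A *v e" "A *v u0"]
        by (simp add: power2_eq_square algebra_simps)
      moreover have "(A *v u0) \<bullet> (A *v e) = e \<bullet> e + c\<^sup>2 * (u0 \<bullet> e)"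
        using transpose_inner[of A "A *v u0" e] by (subst (2) e_def) (simp add: inner_diff_left)
      ultimately have "c\<^sup>2 * (1 + 2 * s * (u0 \<bullet> e) + s\<^sup>2 * (norm e)\<^sup>2)
          \<le> c\<^sup>2 + 2 * s * (e \<bullet> e + c\<^sup>2 * (u0 \<bullet> e)) + s\<^sup>2 * (norm (A *v e))\<^sup>2"
        by (simp only: power_mult_distrib)
      then show ?thesis by (simp add: algebra_simps)
    qed
    then have "e \<bullet> e = 0" by (rule quadratic_nonneg_imp_linear_zero)
    then show ?thesis by (simp add: e_def matrix_vector_mul_assoc)
  qed
  have "sigma_min_pos A = c" unfolding sigma_min_pos_def
  proof (rule Least_equality)
    show "c \<in> singular_values A \<and> c \<noteq> 0"
      using eig u0' \<open>c > 0\<close> by (auto simp: singular_values_def)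
    fix s assume s: "s \<in> singular_values A \<and> s \<noteq> 0"
    then obtain u where u: "s > 0" "u \<noteq> 0" "transpose A *v (A *v u) = s\<^sup>2 *\<^sub>R u"
      by (auto simp: singular_values_def matrix_vector_mul_assoc)
    \<comment> \<open>An eigenvector with nonzero eigenvalue lies in the range of the transpose,
      hence in \<open>ker_perp A\<close>, where \<open>low\<close> applies.\<close>
    have "u = transpose A *v ((1 / s\<^sup>2) *\<^sub>R (A *v u))"
      using u by (simp only: matrix_vector_mult_scaleR) simp
    then have "u \<in> ker_perp A" using transpose_mult_in_ker_perp[of A "(1 / s\<^sup>2) *\<^sub>R (A *v u)"] by (simp only:)
    then have "(c * norm u)\<^sup>2 \<le> (norm (A *v u))\<^sup>2"
      using low \<open>c > 0\<close> by (intro power_mono) auto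
    also have "\<dots> = (s * norm u)\<^sup>2"
      using transpose_inner[of A "A *v u" u] u by (simp add: power2_norm_eq_inner power_mult_distrib)
    finally show "c \<le> s" using u \<open>c > 0\<close> by (simp add: power2_le_iff_abs_le)
  qed
  then show ?thesis using \<open>c > 0\<close> low by simp
qed

text \<open>Shifting \<open>xb\<close> by the kernel component of \<open>x - xb\<close> stays
  feasible, and the residual displacement lies in \<open>ker_perp A\<close>, where \<open>A\<close>
  expands by at least the smallest nonzero singular value.\<close>

lemma affine_projection:
  fixes A :: "real ^ 'n ^ 'r"
  assumes "A \<noteq> 0" "A *v xb = b"
  obtains p where "A *v p = b" "sigma_min_pos A * norm (x - p) \<le> norm (A *v x - b)"
proof -
  obtain k u where ku: "A *v k = 0" "u \<in> ker_perp A" "x - xb = k + u"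
    using ker_perp_decomp .
  show thesis
  proof
    show "A *v (xb + k) = b" using ku assms by (simp add: matrix_vector_right_distrib)
    have "A *v x = A *v (xb + k + u)" using ku(3) by (metis add.assoc add.commute diff_add_cancel)
    then have "A *v x - b = A *v u" using ku assms by (simp add: matrix_vector_right_distrib)
    moreover have "x - (xb + k) = u" using ku(3) by (simp add: algebra_simps)
    ultimately show "sigma_min_pos A * norm (x - (xb + k)) \<le> norm (A *v x - b)"
      using sigma_min_pos_properties[OF assms(1)] ku(2) by simp
  qed
qed

section \<open>Elementary estimates for the energy\<close>

lemma C1_lipschitz_bound:
  fixes h :: "real \<Rightarrow> real"
  assumes der: "\<And>t. 0 \<le> t \<Longrightarrow> (h has_real_derivative h' t) (at t within {0..})"
    and cont: "continuous_on {0..} h'"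
  shows "\<exists>K\<ge>0. \<forall>r\<in>{0..T}. \<forall>s\<in>{0..T}. \<bar>h s - h r\<bar> \<le> K * \<bar>s - r\<bar>"
proof -
  have "bounded (h' ` {0..T})"
    by (intro compact_imp_bounded compact_continuous_image continuous_on_subset[OF cont]) auto
  then obtain K where K: "K > 0" "\<And>t. t \<in> {0..T} \<Longrightarrow> \<bar>h' t\<bar> \<le> K"
    by (auto simp: bounded_pos)
  have "norm (h s - h r) \<le> K * norm (s - r)" if "r \<in> {0..T}" "s \<in> {0..T}" for r s
    using that K(2)
    by (intro field_differentiable_bound[of "{0..T}" h h']) (auto intro: DERIV_subset[OF der])
  then show ?thesis using K(1) by (intro exI[of _ K]) auto
qed

lemma has_real_derivative_norm_diff_squared:
  fixes u :: "real \<Rightarrow> 'a::real_inner"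
  assumes "(u has_vector_derivative u') (at t within S)"
  shows "((\<lambda>t. (norm (u t - c))\<^sup>2) has_real_derivative 2 * (u' \<bullet> (u t - c))) (at t within S)"
proof -
  have d: "((\<lambda>t. u t - c) has_vector_derivative u') (at t within S)"
    using assms by (auto intro!: derivative_eq_intros)
  show ?thesis
    using bounded_bilinear.has_vector_derivative[OF bounded_bilinear_inner d d]
    by (simp add: has_real_derivative_iff_has_vector_derivative power2_norm_eq_inner inner_commute)
qed

lemma norm_squared_diff_le:
  fixes p q :: "'a::real_inner"
  assumes "norm p \<le> W" "norm q \<le> W"
  shows "\<bar>(norm p)\<^sup>2 - (norm q)\<^sup>2\<bar> \<le> 2 * W * norm (p - q)"
proof -
  have "(norm p)\<^sup>2 - (norm q)\<^sup>2 = (norm p + norm q) * (norm p - norm q)"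
    by (simp add: power2_eq_square algebra_simps)
  then have "\<bar>(norm p)\<^sup>2 - (norm q)\<^sup>2\<bar> = (norm p + norm q) * \<bar>norm p - norm q\<bar>"
    by (simp add: abs_mult)
  also have "\<dots> \<le> (2 * W) * norm (p - q)"
    using assms norm_triangle_ineq3[of p q] by (intro mult_mono) (auto intro: order_trans[OF norm_ge_zero])
  finally show ?thesis .
qed

text \<open>The parallelogram law without the term in \<open>p + q\<close>. The factor 2 cancels the
  halves in the energy, as in \<open>C0\<close>.\<close>

lemma norm_diff_squared_le: "(norm (p - q))\<^sup>2 \<le> 2 * ((norm p)\<^sup>2 + (norm q)\<^sup>2)" for p q :: "'a::real_inner"
proof -
  have "0 \<le> (norm (p + q))\<^sup>2" by simp
  then show ?thesis
    by (simp add: power2_norm_eq_inner inner_add inner_diff inner_commute algebra_simps)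
qed

text \<open>The left side is \<open>exp (- t)\<close> times the derivative of \<open>exp t\<close>
  times the energy, with \<open>g\<close> the gradient at an active index. The terms in
  \<open>\<zeta>\<close> and \<open>\<xi>\<close> cancel because \<open>A *v xh = b\<close>; the
  terms in \<open>\<mu>\<close> combine by a three-point identity. Replacing \<open>g\<close> by the
  minimizer \<open>z\<close> only increases the rest, which the third assumption bounds.\<close>

lemma dissipation_inequality:
  fixes A :: "real ^ 'n ^ 'r"
  assumes "A *v xh = b" and "(x - v) \<bullet> z \<le> (x - v) \<bullet> g"
    and "(xh - x) \<bullet> z + \<mu> / 2 * (norm (x - xh))\<^sup>2 \<le> - M" and "0 \<le> \<mu>"
  shows "M + \<zeta> \<bullet> (A *v x - b) + ((v - x) \<bullet> g + \<zeta> \<bullet> (A *v (v - x))) + (A *v v - b) \<bullet> (\<xi> - \<zeta>)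
    + (\<mu> / 2 * (norm (v - xh))\<^sup>2 + (\<mu> *\<^sub>R (x - v) - transpose A *v \<xi> - z) \<bullet> (v - xh)) \<le> 0"
proof -
  have "(transpose A *v \<xi>) \<bullet> (v - xh) = \<xi> \<bullet> (A *v v - b)"
    unfolding transpose_inner using assms(1) by (simp add: matrix_vector_mult_diff_distrib)
  moreover have "\<zeta> \<bullet> (A *v x - b) + \<zeta> \<bullet> (A *v (v - x)) + (A *v v - b) \<bullet> (\<xi> - \<zeta>) = \<xi> \<bullet> (A *v v - b)"
    by (simp add: matrix_vector_mult_diff_distrib inner_diff inner_commute)
  moreover have "\<mu> / 2 * (norm (v - xh))\<^sup>2 + \<mu> * ((x - v) \<bullet> (v - xh))
      = \<mu> / 2 * (norm (x - xh))\<^sup>2 - \<mu> / 2 * (norm (x - v))\<^sup>2"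
    by (simp add: power2_norm_eq_inner inner_diff inner_commute algebra_simps)
  moreover have "0 \<le> \<mu> / 2 * (norm (x - v))\<^sup>2" using assms(4) by simp
  moreover have "(xh - x) \<bullet> z - (v - x) \<bullet> z = - (z \<bullet> (v - xh))"
    by (simp add: inner_diff inner_commute)
  ultimately show ?thesis using assms(2,3)
    by (simp add: inner_diff_left[of _ _ "v - xh"] inner_diff_left[of x v] inner_diff_left[of v x])
qed

section \<open>The dynamical system: bounds on the objectives, weights and regularity\<close>

locale ampd_di =
  fixes A :: "real ^ 'n ^ 'r" and b :: "real ^ 'r"
    and f :: "'m::finite \<Rightarrow> real ^ 'n \<Rightarrow> real"
    and \<mu>s Ls :: "'m \<Rightarrow> real" and \<mu> L :: real
    and \<theta> \<gamma> :: "real \<Rightarrow> real" and \<theta>0 \<gamma>0 :: real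
    and x v :: "real \<Rightarrow> real ^ 'n" and \<xi> :: "real \<Rightarrow> real ^ 'r"
    and x0 v0 :: "real ^ 'n" and \<xi>0 :: "real ^ 'r"
  assumes moduli: "\<And>j. 0 \<le> \<mu>s j \<and> \<mu>s j \<le> Ls j"
    and C1: "\<And>j. C1_fun (f j)"
    and lipschitz: "\<And>j. (Ls j)-lipschitz_on UNIV (grad (f j))"
    and strong_convexity: "\<And>j x y. f j y - f j x - grad (f j) x \<bullet> (y - x) \<ge> \<mu>s j / 2 * (norm (x - y))\<^sup>2"
    and \<mu>_def: "\<mu> = Min (range \<mu>s)" and L_def: "L = Max (range Ls)"
    and \<theta>0_pos: "\<theta>0 > 0" and \<gamma>0_pos: "\<gamma>0 > 0"
    and \<theta>_init: "\<theta> 0 = \<theta>0"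
    and \<theta>_deriv: "\<And>t. t \<ge> 0 \<Longrightarrow> (\<theta> has_real_derivative - \<theta> t) (at t within {0..})"
    and \<gamma>_init: "\<gamma> 0 = \<gamma>0"
    and \<gamma>_deriv: "\<And>t. t \<ge> 0 \<Longrightarrow> (\<gamma> has_real_derivative \<mu> - \<gamma> t) (at t within {0..})"
    and solution: "ampd_di_solution A b f \<mu> \<theta> \<gamma> x0 v0 \<xi>0 x v \<xi>"
begin

lemma \<mu>_le: "\<mu> \<le> \<mu>s j"
  unfolding \<mu>_def by (rule Min_range_le)

lemma \<mu>_nonneg: "0 \<le> \<mu>"
  using Min_range_in[of \<mu>s] moduli unfolding \<mu>_def by metis

lemma L_ge: "Ls j \<le> L"
  unfolding L_def by simp

lemma L_nonneg: "0 \<le> L"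
  using L_ge moduli by (meson order_trans)

lemma max_grad0_ge: "norm (grad (f j) 0) \<le> max_grad0 f"
  unfolding max_grad0_def by simp

lemma max_grad0_nonneg: "0 \<le> max_grad0 f"
  using max_grad0_ge norm_ge_zero order_trans by blast

lemma norm_grad_le: "norm (grad (f j) y) \<le> max_grad0 f + L * norm y"
proof -
  have "norm (grad (f j) y - grad (f j) 0) \<le> Ls j * norm y"
    using lipschitz_onD[OF lipschitz[of j], of y 0] by (simp add: dist_norm)
  also have "\<dots> \<le> L * norm y" using L_ge by (simp add: mult_right_mono)
  finally show ?thesis
    using max_grad0_ge[of j] norm_triangle_sub[of "grad (f j) y" "grad (f j) 0"] by linarith
qed

lemma f_ge_linear: "f j y + grad (f j) y \<bullet> (z - y) \<le> f j z"
proof -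
  have "0 \<le> \<mu>s j / 2 * (norm (y - z))\<^sup>2" using moduli[of j] by simp
  then show ?thesis using strong_convexity[of j y z] by linarith
qed

text \<open>Convexity at \<open>y\<close> needs only the gradient at \<open>y\<close>, so the slope
  involves \<open>norm y\<close> but not \<open>norm z\<close>.\<close>

lemma f_diff_le: "f j y - f j z \<le> (max_grad0 f + L * norm y) * (norm y + norm z)"
proof -
  have "f j y - f j z \<le> grad (f j) y \<bullet> (y - z)"
    using f_ge_linear[of j y z] by (simp add: inner_diff_right)
  also have "\<dots> \<le> norm (grad (f j) y) * norm (y - z)" by (rule norm_cauchy_schwarz)
  also have "\<dots> \<le> (max_grad0 f + L * norm y) * (norm y + norm z)"
    using norm_grad_le max_grad0_nonneg L_nonneg by (intro mult_mono norm_triangle_ineq4) auto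
  finally show ?thesis .
qed

lemma \<theta>_exp:
  assumes "0 \<le> t"
  shows "exp t * \<theta> t = \<theta>0"
proof -
  have "((\<lambda>t. exp t * \<theta> t) has_real_derivative 0) (at t within {0..})" if "t \<in> {0..}" for t
    using that by (auto intro!: derivative_eq_intros \<theta>_deriv)
  from has_field_derivative_zero_constant[OF _ this]
  obtain c where c: "\<And>t. t \<ge> 0 \<Longrightarrow> exp t * \<theta> t = c" by auto
  show ?thesis using c[OF assms] c[of 0] \<theta>_init by simp
qed

text \<open>The closed form of \<open>exp t * \<gamma> t\<close>, obtained with \<open>exp t\<close>
  as integrating factor. It is smooth on the whole line, and monotone since \<open>\<mu>\<close> is
  nonnegative.\<close>

definition p :: "real \<Rightarrow> real" where
  "p t = \<gamma>0 + \<mu> * (exp t - 1)"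

lemma p_deriv: "(p has_real_derivative \<mu> * exp t) (at t within S)"
  unfolding p_def by (auto intro!: derivative_eq_intros)

lemma p_nonneg: "0 \<le> t \<Longrightarrow> 0 \<le> p t"
  using \<mu>_nonneg \<gamma>0_pos by (simp add: p_def)

lemma \<gamma>_exp:
  assumes "0 \<le> t"
  shows "exp t * \<gamma> t = p t"
proof -
  have "((\<lambda>t. exp t * \<gamma> t - p t) has_real_derivative 0) (at t within {0..})" if "t \<in> {0..}" for t
    using that by (auto intro!: derivative_eq_intros \<gamma>_deriv p_deriv simp: algebra_simps)
  from has_field_derivative_zero_constant[OF _ this]
  obtain c where c: "\<And>t. t \<ge> 0 \<Longrightarrow> exp t * \<gamma> t - p t = c" by auto
  show ?thesis using c[OF assms] c[of 0] \<gamma>_init by (simp add: p_def)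
qed

lemma initial: "x 0 = x0" "v 0 = v0" "\<xi> 0 = \<xi>0"
  using solution by (auto simp: ampd_di_solution_def)

lemma x_deriv:
  assumes "0 \<le> t"
  shows "(x has_vector_derivative v t - x t) (at t within {0..})"
  using solution assms vector_derivative_works[of x "at t within {0..}"]
  unfolding ampd_di_solution_def C1_ray_def by simp

lemma \<xi>_deriv:
  assumes "0 \<le> t"
  shows "(\<xi> has_vector_derivative (exp t / \<theta>0) *\<^sub>R (A *v v t - b)) (at t within {0..})"
proof -
  define d where "d = vector_derivative \<xi> (at t within {0..})"
  have d: "(\<xi> has_vector_derivative d) (at t within {0..})" "\<theta> t *\<^sub>R d = A *v v t - b"
    using solution assms vector_derivative_works[of \<xi> "at t within {0..}"]
    unfolding ampd_di_solution_def C1_ray_def d_def by simp_all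
  have "exp t / \<theta>0 * \<theta> t = 1" using \<theta>_exp[OF assms] \<theta>0_pos by simp
  then have "(exp t / \<theta>0) *\<^sub>R (A *v v t - b) = d"
    unfolding d(2)[symmetric] scaleR_scaleR by (simp only: scaleR_one)
  with d(1) show ?thesis by simp
qed

lemma continuous_x: "continuous_on {0..} x"
  using x_deriv by (auto simp: continuous_on_eq_continuous_within intro: has_vector_derivative_continuous)

lemma continuous_\<xi>: "continuous_on {0..} \<xi>"
  using \<xi>_deriv by (auto simp: continuous_on_eq_continuous_within intro: has_vector_derivative_continuous)

text \<open>The identity \<open>v = x' + x\<close> writes \<open>v\<close> as a sum of two
  continuous functions.\<close>

lemma continuous_v: "continuous_on {0..} v"
proof -
  have "continuous_on {0..} (\<lambda>t. vector_derivative x (at t within {0..}) + x t)"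
    using solution continuous_x unfolding ampd_di_solution_def C1_ray_def
    by (intro continuous_on_add) auto
  then show ?thesis
    using solution unfolding ampd_di_solution_def by (elim continuous_on_eq) auto
qed

section \<open>Monotonicity of the weighted energy\<close>

lemma GDERIV_f: "GDERIV (f j) y :> grad (f j) y"
  using C1 by (intro GDERIV_grad) (simp add: C1_fun_def)

text \<open>Multiplied by \<open>exp t\<close>, the energy with index \<open>j\<close> in place of the minimum is \<open>P xh \<zeta> j t + Q xh t\<close>: the weights
  become \<open>exp t * \<theta> t = \<theta>0\<close> and \<open>exp t * \<gamma> t = p t\<close>. Only \<open>Q\<close> depends on the merely absolutely continuous \<open>v\<close>;
  \<open>P\<close> is \<open>C\<^sup>1\<close>.\<close>

definition P :: "real ^ 'n \<Rightarrow> real ^ 'r \<Rightarrow> 'm \<Rightarrow> real \<Rightarrow> real" where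
  "P xh \<zeta> j t = exp t * (f j (x t) - f j xh + \<zeta> \<bullet> (A *v x t - b)) + \<theta>0 / 2 * (norm (\<xi> t - \<zeta>))\<^sup>2"

definition Q :: "real ^ 'n \<Rightarrow> real \<Rightarrow> real" where
  "Q xh t = p t / 2 * (norm (v t - xh))\<^sup>2"

text \<open>The derivative of \<open>P\<close> along the system. The factor \<open>exp t\<close> in
  the derivative of \<open>\<xi>\<close> lets the multiplier term share the common factor.\<close>

definition P' :: "real ^ 'n \<Rightarrow> real ^ 'r \<Rightarrow> 'm \<Rightarrow> real \<Rightarrow> real" where
  "P' xh \<zeta> j t = exp t * (f j (x t) - f j xh + \<zeta> \<bullet> (A *v x t - b)
     + ((v t - x t) \<bullet> grad (f j) (x t) + \<zeta> \<bullet> (A *v (v t - x t))) + (A *v v t - b) \<bullet> (\<xi> t - \<zeta>))"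

lemma P_deriv:
  assumes "0 \<le> t"
  shows "(P xh \<zeta> j has_real_derivative P' xh \<zeta> j t) (at t within {0..})"
proof -
  have x: "(x has_derivative (\<lambda>h. h *\<^sub>R (v t - x t))) (at t within {0..})"
    using x_deriv[OF assms] by (simp add: has_vector_derivative_def)
  have "((\<lambda>t. f j (x t)) has_derivative (\<lambda>h. (h *\<^sub>R (v t - x t)) \<bullet> grad (f j) (x t))) (at t within {0..})"
    using has_derivative_compose[OF x GDERIV_f[unfolded gderiv_def]] .
  then have fx: "((\<lambda>t. f j (x t)) has_real_derivative (v t - x t) \<bullet> grad (f j) (x t)) (at t within {0..})"
    by (simp add: has_field_derivative_def mult_commute_abs)
  have "((\<lambda>t. \<zeta> \<bullet> (A *v x t)) has_vector_derivative \<zeta> \<bullet> (A *v (v t - x t))) (at t within {0..})"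
    by (intro bounded_linear.has_vector_derivative[OF bounded_linear_inner_right]
        bounded_linear.has_vector_derivative[OF matrix_vector_mul_bounded_linear] x_deriv assms)
  then have Ax: "((\<lambda>t. \<zeta> \<bullet> (A *v x t)) has_real_derivative \<zeta> \<bullet> (A *v (v t - x t))) (at t within {0..})"
    by (simp add: has_real_derivative_iff_has_vector_derivative)
  have "((\<lambda>t. exp t * (f j (x t) - f j xh + (\<zeta> \<bullet> (A *v x t) - \<zeta> \<bullet> b)) + \<theta>0 / 2 * (norm (\<xi> t - \<zeta>))\<^sup>2) has_real_derivative
      exp t * (((v t - x t) \<bullet> grad (f j) (x t) - 0) + (\<zeta> \<bullet> (A *v (v t - x t)) - 0))
      + exp t * (f j (x t) - f j xh + (\<zeta> \<bullet> (A *v x t) - \<zeta> \<bullet> b))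
      + \<theta>0 / 2 * (2 * (((exp t / \<theta>0) *\<^sub>R (A *v v t - b)) \<bullet> (\<xi> t - \<zeta>)))) (at t within {0..})"
    by (intro DERIV_add DERIV_mult' DERIV_diff DERIV_const DERIV_cmult fx Ax
        has_real_derivative_norm_diff_squared \<xi>_deriv assms DERIV_subset[OF DERIV_exp subset_UNIV])
  moreover have "\<theta>0 / 2 * (2 * (((exp t / \<theta>0) *\<^sub>R (A *v v t - b)) \<bullet> (\<xi> t - \<zeta>))) = exp t * ((A *v v t - b) \<bullet> (\<xi> t - \<zeta>))"
    using \<theta>0_pos by simp
  ultimately show ?thesis
    unfolding P_def[abs_def] P'_def inner_diff_right[of \<zeta> _ b] by (simp add: distrib_left add_ac)
qed

lemma continuous_P': "continuous_on {0..} (P' xh \<zeta> j)"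
proof -
  have f: "continuous_on UNIV (f j)"
    by (intro continuous_at_imp_continuous_on ballI has_derivative_continuous[OF GDERIV_f[unfolded gderiv_def]])
  have g: "continuous_on UNIV (grad (f j))" using C1 by (simp add: C1_fun_def)
  have 1: "continuous_on {0..} (\<lambda>t. f j (x t))" "continuous_on {0..} (\<lambda>t. grad (f j) (x t))"
    by (rule continuous_on_compose2[OF f continuous_x] continuous_on_compose2[OF g continuous_x]; simp)+
  have A: "continuous_on {0..} (\<lambda>t. A *v u t)" if "continuous_on {0..} u" for u
    using that by (rule continuous_on_compose2[OF matrix_vector_mult_linear_continuous_on[of UNIV]]) simp
  show ?thesis
    unfolding P'_def[abs_def]
    by (intro continuous_intros 1 A continuous_x continuous_v continuous_\<xi>)
qed

text \<open>This is \<open>exp t\<close> times the energy, so exponential decay of the energy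
  becomes monotonicity of \<open>V\<close>.\<close>

definition V :: "real ^ 'n \<Rightarrow> real ^ 'r \<Rightarrow> real \<Rightarrow> real" where
  "V xh \<zeta> t = Min (range (\<lambda>j. P xh \<zeta> j t + Q xh t))"

text \<open>Each \<open>P\<close> is Lipschitz on the compact interval; \<open>Q\<close> is a
  Lipschitz weight times the square of a bounded curve, so its increments are controlled by those of
  \<open>v\<close> and of time. A minimum inherits a bound common to all indices.\<close>

lemma abs_cont_V:
  assumes "0 < T"
  shows "abs_cont_on {0..T} (V xh \<zeta>)"
proof -
  have v: "abs_cont_on {0..T} v"
    using solution assms by (simp add: ampd_di_solution_def abs_cont_ray_def)
  have "\<exists>K\<ge>0. \<forall>r\<in>{0..T}. \<forall>s\<in>{0..T}. \<bar>P xh \<zeta> j s - P xh \<zeta> j r\<bar> \<le> K * \<bar>s - r\<bar>" for j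
    using P_deriv continuous_P' by (rule C1_lipschitz_bound)
  then obtain KP where KP: "\<And>j. KP j \<ge> 0" "\<And>j r s. r \<in> {0..T} \<Longrightarrow> s \<in> {0..T} \<Longrightarrow>
      \<bar>P xh \<zeta> j s - P xh \<zeta> j r\<bar> \<le> KP j * \<bar>s - r\<bar>" by metis
  define K where "K = Max (range KP)"
  have KPK: "KP j \<le> K" for j unfolding K_def by simp
  have "K \<ge> 0" using KP(1) KPK order_trans by blast
  have "\<exists>K\<ge>0. \<forall>r\<in>{0..T}. \<forall>s\<in>{0..T}. \<bar>p s - p r\<bar> \<le> K * \<bar>s - r\<bar>"
    using p_deriv by (rule C1_lipschitz_bound) (auto intro!: continuous_intros)
  then obtain J where J: "J \<ge> 0" "\<And>r s. r \<in> {0..T} \<Longrightarrow> s \<in> {0..T} \<Longrightarrow> \<bar>p s - p r\<bar> \<le> J * \<bar>s - r\<bar>"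
    by blast
  have "bounded ((\<lambda>t. v t - xh) ` {0..T})" 
    by (intro compact_imp_bounded compact_continuous_image continuous_intros
        continuous_on_subset[OF continuous_v]) auto
  then obtain W where W: "W > 0" "\<And>t. t \<in> {0..T} \<Longrightarrow> norm (v t - xh) \<le> W"
    by (auto simp: bounded_pos)
  have pT: "0 \<le> p t \<and> p t \<le> p T" if "t \<in> {0..T}" for t
  proof
    show "0 \<le> p t" using that by (intro p_nonneg) simp
    show "p t \<le> p T" unfolding p_def
      using that \<mu>_nonneg by (intro add_left_mono mult_left_mono diff_right_mono) auto
  qed
  have Q: "\<bar>Q xh s - Q xh r\<bar> \<le> p T * W * norm (v s - v r) + J * W\<^sup>2 * \<bar>s - r\<bar>"
    if rs: "r \<in> {0..T}" "s \<in> {0..T}" for r s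
  proof -
    \<comment> \<open>A discrete product rule: first the square changes with the weight frozen at
      \<open>s\<close>, then the weight changes with the square frozen at \<open>r\<close>.\<close>
    have "Q xh s - Q xh r = p s / 2 * ((norm (v s - xh))\<^sup>2 - (norm (v r - xh))\<^sup>2)
        + (p s - p r) / 2 * (norm (v r - xh))\<^sup>2"
      by (simp add: Q_def right_diff_distrib left_diff_distrib diff_divide_distrib)
    then have "\<bar>Q xh s - Q xh r\<bar> \<le> p s / 2 * \<bar>(norm (v s - xh))\<^sup>2 - (norm (v r - xh))\<^sup>2\<bar>
        + \<bar>p s - p r\<bar> / 2 * (norm (v r - xh))\<^sup>2"
      using pT[OF rs(2)] abs_triangle_ineq[of "p s / 2 * ((norm (v s - xh))\<^sup>2 - (norm (v r - xh))\<^sup>2)"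
          "(p s - p r) / 2 * (norm (v r - xh))\<^sup>2"]
      by (simp add: abs_mult)
    also have "\<dots> \<le> p T / 2 * (2 * W * norm (v s - v r)) + (J * \<bar>s - r\<bar>) * W\<^sup>2"
    proof (intro add_mono mult_mono power_mono)
      show "\<bar>(norm (v s - xh))\<^sup>2 - (norm (v r - xh))\<^sup>2\<bar> \<le> 2 * W * norm (v s - v r)"
        using norm_squared_diff_le[OF W(2)[OF rs(2)] W(2)[OF rs(1)]] by simp
      show "\<bar>p s - p r\<bar> / 2 \<le> J * \<bar>s - r\<bar>" 
        by (rule order_trans[OF _ J(2)[OF rs]]) simp
    qed (use pT rs W J p_nonneg in auto)
    finally show ?thesis by (simp add: mult_ac)
  qed
  define K' where "K' = K + J * W\<^sup>2 + p T * W"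
  have nn: "0 \<le> J * W\<^sup>2" "0 \<le> p T * W" using J W pT[of T] assms by auto
  have PQ: "(P xh \<zeta> j s + Q xh s) - (P xh \<zeta> j r + Q xh r) \<le> K' * (\<bar>s - r\<bar> + norm (v s - v r))"
    if rs: "r \<in> {0..T}" "s \<in> {0..T}" for r s j
  proof -
    have "\<bar>P xh \<zeta> j s - P xh \<zeta> j r\<bar> \<le> K * \<bar>s - r\<bar>"
      using KP(2)[OF rs, of j] mult_right_mono[OF KPK[of j] abs_ge_zero[of "s - r"]] by linarith
    moreover have "0 \<le> K * norm (v s - v r)" "0 \<le> J * W\<^sup>2 * norm (v s - v r)" "0 \<le> p T * W * \<bar>s - r\<bar>"
      using nn \<open>K \<ge> 0\<close> by (auto intro!: mult_nonneg_nonneg)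
    ultimately show ?thesis using Q[OF rs] unfolding K'_def by (simp add: distrib_left distrib_right)
  qed
  show ?thesis
  proof (rule abs_cont_on_dominated[OF v])
    show "0 \<le> K'" using nn \<open>K \<ge> 0\<close> by (simp add: K'_def)
    fix r s assume rs: "r \<in> {0..T}" "s \<in> {0..T}" "r \<le> s"
    have "V xh \<zeta> s - V xh \<zeta> r \<le> K' * (\<bar>s - r\<bar> + norm (v s - v r))"
      unfolding V_def by (intro Min_range_diff_le PQ rs)
    moreover have "V xh \<zeta> r - V xh \<zeta> s \<le> K' * (\<bar>r - s\<bar> + norm (v r - v s))"
      unfolding V_def by (intro Min_range_diff_le PQ rs)
    ultimately show "norm (V xh \<zeta> s - V xh \<zeta> r) \<le> K' * ((s - r) + norm (v s - v r))"
      using rs(3) by (simp add: abs_le_iff norm_minus_commute)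
  qed
qed

text \<open>Off a null set the inclusion holds and \<open>v\<close> is differentiable. There every
  active index has a nonpositive derivative by the dissipation inequality, which yields the slope
  condition of the monotonicity criterion.\<close>

lemma V_nonincreasing:
  assumes xh: "A *v xh = b" and "0 \<le> T"
  shows "V xh \<zeta> T \<le> V xh \<zeta> 0"
proof (cases "T = 0")
  case False
  with assms(2) have "0 < T" by simp
  define incl where "incl t \<longleftrightarrow> v differentiable (at t within {0..}) \<and>
        \<gamma> t *\<^sub>R vector_derivative v (at t within {0..}) \<in>
          {\<mu> *\<^sub>R (x t - v t) - transpose A *v \<xi> t - z | z.
             is_arg_min (\<lambda>z. (x t - v t) \<bullet> z) (\<lambda>z. z \<in> grad_hull f (x t)) z}" for t
  have "AE t in lebesgue. t \<ge> 0 \<longrightarrow> incl t"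
    using solution by (simp add: ampd_di_solution_def incl_def)
  then obtain N where N: "N \<in> null_sets lebesgue" "\<And>t. 0 \<le> t \<Longrightarrow> t \<notin> N \<Longrightarrow> incl t"
    by (auto simp: eventually_ae_filter subset_iff)
  show ?thesis
  proof (rule abs_cont_on_nonincreasing[OF assms(2) abs_cont_V[OF \<open>0 < T\<close>]])
    show "negligible N" using N(1) by (simp add: negligible_iff_null_sets)
    fix t e :: real assume t: "t \<in> {0..T} - N" and "0 < e"
    then have "0 \<le> t" by simp
    obtain w z where w: "(v has_vector_derivative w) (at t within {0..})"
        "\<gamma> t *\<^sub>R w = \<mu> *\<^sub>R (x t - v t) - transpose A *v \<xi> t - z"
      and z: "is_arg_min (\<lambda>z. (x t - v t) \<bullet> z) (\<lambda>z. z \<in> grad_hull f (x t)) z"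
      using N(2)[of t] t vector_derivative_works[of v "at t within {0..}"]
      unfolding incl_def by auto
    \<comment> \<open>Since \<open>p\<close> is \<open>exp t * \<gamma> t\<close>, the derivative of
      \<open>Q\<close> contains \<open>v'\<close> only through
      \<open>\<gamma> t *\<^sub>R w\<close>, for which the inclusion can be substituted.\<close>
    define Q' where "Q' = exp t * (\<mu> / 2 * (norm (v t - xh))\<^sup>2 + (\<gamma> t *\<^sub>R w) \<bullet> (v t - xh))"
    have "((\<lambda>t. p t * (norm (v t - xh))\<^sup>2 / 2) has_real_derivative
        (p t * (2 * (w \<bullet> (v t - xh))) + \<mu> * exp t * (norm (v t - xh))\<^sup>2) / 2) (at t within {0..})"
      by (intro DERIV_cdivide DERIV_mult' p_deriv has_real_derivative_norm_diff_squared w(1))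
    moreover have "(p t * (2 * (w \<bullet> (v t - xh))) + \<mu> * exp t * (norm (v t - xh))\<^sup>2) / 2 = Q'"
      by (simp add: Q'_def \<gamma>_exp[OF \<open>0 \<le> t\<close>, symmetric] distrib_left add_divide_distrib)
    ultimately have Q': "(Q xh has_real_derivative Q') (at t within {0..})"
      by (simp add: Q_def[abs_def])
    have "P' xh \<zeta> j t + Q' \<le> 0"
      if act: "P xh \<zeta> j t + Q xh t = Min (range (\<lambda>i. P xh \<zeta> i t + Q xh t))" for j
    proof -
      define M where "M = f j (x t) - f j xh"
      \<comment> \<open>The functions \<open>P\<close> at different indices differ only by the
        objective gaps, so an active index minimizes the gap.\<close>
      have "P xh \<zeta> j t \<le> P xh \<zeta> i t" for i
        using Min_range_le[of "\<lambda>i. P xh \<zeta> i t + Q xh t" i, folded act] by linarith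
      then have M: "M \<le> f i (x t) - f i xh" for i
        by (simp add: P_def M_def)
      \<comment> \<open>Strong convexity with the common modulus \<open>\<mu>\<close> puts every
        gradient in one half-space; convexity of the half-space extends this to the hull and hence
        to \<open>z\<close>.\<close>
      have "grad_hull f (x t) \<subseteq> {y. (xh - x t) \<bullet> y \<le> - M - \<mu> / 2 * (norm (x t - xh))\<^sup>2}"
        unfolding grad_hull_def
      proof (rule hull_minimal)
        show "range (\<lambda>i. grad (f i) (x t)) \<subseteq> {y. (xh - x t) \<bullet> y \<le> - M - \<mu> / 2 * (norm (x t - xh))\<^sup>2}"
        proof clarify
          fix i
          have "\<mu> / 2 * (norm (x t - xh))\<^sup>2 \<le> \<mu>s i / 2 * (norm (x t - xh))\<^sup>2"
            using \<mu>_le by (intro mult_right_mono) auto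
          then show "(xh - x t) \<bullet> grad (f i) (x t) \<le> - M - \<mu> / 2 * (norm (x t - xh))\<^sup>2"
            using strong_convexity[of i "x t" xh] M[of i] by (simp add: inner_commute)
        qed
      qed (rule convex_halfspace_le)
      moreover have "z \<in> grad_hull f (x t)" using z by (simp add: is_arg_min_def)
      ultimately have zM: "(xh - x t) \<bullet> z + \<mu> / 2 * (norm (x t - xh))\<^sup>2 \<le> - M" by auto
      have "grad (f j) (x t) \<in> grad_hull f (x t)"
        unfolding grad_hull_def by (intro hull_inc) auto
      then have "(x t - v t) \<bullet> z \<le> (x t - v t) \<bullet> grad (f j) (x t)"
        using z by (auto simp: is_arg_min_def not_less)
      from dissipation_inequality[OF xh this zM \<mu>_nonneg, of \<zeta> "\<xi> t"]
      show ?thesis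
        unfolding P'_def Q'_def w(2) M_def distrib_left[symmetric]
        by (intro mult_nonneg_nonpos) auto
    qed
    then obtain d where d: "d > 0" "\<forall>r\<in>{0..}. \<forall>s\<in>{0..}. t - d < r \<and> r \<le> t \<and> t \<le> s \<and> s < t + d \<longrightarrow>
        V xh \<zeta> s - V xh \<zeta> r \<le> e * (s - r)"
      using Min_upper_slope[of "\<lambda>j t. P xh \<zeta> j t + Q xh t" "\<lambda>j. P' xh \<zeta> j t + Q'" t "{0..}" e]
        DERIV_add[OF P_deriv[OF \<open>0 \<le> t\<close>] Q'] \<open>0 < e\<close> unfolding V_def by blast
    then show "\<exists>d>0. \<forall>r\<in>{0..T}. \<forall>s\<in>{0..T}. t - d < r \<and> r \<le> t \<and> t \<le> s \<and> s < t + d \<longrightarrow>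
        V xh \<zeta> s - V xh \<zeta> r \<le> e * (s - r)"
      by (intro exI[of _ d]) auto
  qed
qed simp

section \<open>Boundedness of the trajectory and decay of the constraint violation\<close>

lemma C0_mono:
  assumes "0 \<le> s" "s \<le> s'" "0 \<le> t" "t \<le> t'"
  shows "C0 A b f L \<theta>0 \<gamma>0 x0 v0 \<xi>0 s t \<le> C0 A b f L \<theta>0 \<gamma>0 x0 v0 \<xi>0 s' t'"
  unfolding C0_def using assms max_grad0_nonneg L_nonneg \<theta>0_pos \<gamma>0_pos
  by (intro add_mono mult_mono mult_left_mono add_left_mono power_mono) auto

lemma C0_nonneg:
  assumes "0 \<le> s" "0 \<le> t"
  shows "0 \<le> C0 A b f L \<theta>0 \<gamma>0 x0 v0 \<xi>0 s t"
  unfolding C0_def using assms max_grad0_nonneg L_nonneg \<theta>0_pos \<gamma>0_pos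
  by (intro add_nonneg_nonneg mult_nonneg_nonneg) auto

lemma V_initial_le: "V xh \<zeta> 0 \<le> C0 A b f L \<theta>0 \<gamma>0 x0 v0 \<xi>0 (norm xh) (norm \<zeta>)"
proof -
  fix j :: 'm
  have "V xh \<zeta> 0 \<le> P xh \<zeta> j 0 + Q xh 0" unfolding V_def by (rule Min_range_le)
  also have "\<dots> = f j x0 - f j xh + \<zeta> \<bullet> (A *v x0 - b) + \<theta>0 / 2 * (norm (\<xi>0 - \<zeta>))\<^sup>2 + \<gamma>0 / 2 * (norm (v0 - xh))\<^sup>2"
    by (simp add: P_def Q_def p_def initial)
  also have "\<dots> \<le> ((max_grad0 f + L * norm xh) * (norm x0 + norm xh) + L * ((norm x0)\<^sup>2 + (norm xh)\<^sup>2))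
      + norm \<zeta> * norm (A *v x0 - b) + \<theta>0 * ((norm \<xi>0)\<^sup>2 + (norm \<zeta>)\<^sup>2) + \<gamma>0 * ((norm v0)\<^sup>2 + (norm xh)\<^sup>2)"
  proof (intro add_mono norm_cauchy_schwarz)
    \<comment> \<open>The bound from \<open>f_diff_le\<close> has \<open>norm x0\<close> in its
      slope. After expansion the target exceeds it by twice this term.\<close>
    have "0 \<le> L * (norm xh)\<^sup>2" using L_nonneg by simp
    then show "f j x0 - f j xh \<le> (max_grad0 f + L * norm xh) * (norm x0 + norm xh) + L * ((norm x0)\<^sup>2 + (norm xh)\<^sup>2)"
      using f_diff_le[of j x0 xh] by (simp add: algebra_simps power2_eq_square)
    show "\<theta>0 / 2 * (norm (\<xi>0 - \<zeta>))\<^sup>2 \<le> \<theta>0 * ((norm \<xi>0)\<^sup>2 + (norm \<zeta>)\<^sup>2)"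
      using mult_left_mono[OF norm_diff_squared_le[of \<xi>0 \<zeta>], of "\<theta>0 / 2"] \<theta>0_pos by simp
    show "\<gamma>0 / 2 * (norm (v0 - xh))\<^sup>2 \<le> \<gamma>0 * ((norm v0)\<^sup>2 + (norm xh)\<^sup>2)"
      using mult_left_mono[OF norm_diff_squared_le[of v0 xh], of "\<gamma>0 / 2"] \<gamma>0_pos by simp
  qed
  finally show ?thesis by (simp add: C0_def)
qed

text \<open>The quadratic terms are dropped at time \<open>t\<close> and estimated at time 0. The
  bound holds for every feasible \<open>xh\<close> and every \<open>\<zeta>\<close>, so both may
  afterwards be chosen depending on \<open>t\<close>.\<close>

lemma lyapunov_decay:
  assumes "A *v xh = b" "0 \<le> t"
  shows "exp t * (Min (range (\<lambda>j. f j (x t) - f j xh)) + \<zeta> \<bullet> (A *v x t - b))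
    \<le> C0 A b f L \<theta>0 \<gamma>0 x0 v0 \<xi>0 (norm xh) (norm \<zeta>)"
proof -
  obtain j where j: "P xh \<zeta> j t + Q xh t = V xh \<zeta> t"
    using Min_range_in[of "\<lambda>j. P xh \<zeta> j t + Q xh t"] unfolding V_def .
  have "exp t * (Min (range (\<lambda>j. f j (x t) - f j xh)) + \<zeta> \<bullet> (A *v x t - b))
      \<le> exp t * (f j (x t) - f j xh + \<zeta> \<bullet> (A *v x t - b))"
    by (intro mult_left_mono add_right_mono) auto
  also have "\<dots> \<le> V xh \<zeta> t"
    unfolding j[symmetric] P_def Q_def using \<theta>0_pos p_nonneg[OF assms(2)] by simp
  also have "\<dots> \<le> V xh \<zeta> 0" by (rule V_nonincreasing[OF assms])
  also have "\<dots> \<le> C0 A b f L \<theta>0 \<gamma>0 x0 v0 \<xi>0 (norm xh) (norm \<zeta>)" by (rule V_initial_le)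
  finally show ?thesis .
qed

text \<open>Decay with \<open>\<zeta> = 0\<close> bounds one gap \<open>f j (x t) - f j xb\<close>.
  The three summands of \<open>alpha0\<close> bound this gap, the change from \<open>xb\<close> to
  \<open>x0\<close>, and \<open>f j x0\<close>. The index may vary with \<open>t\<close>, whence the
  maximum over all indices in \<open>R_level\<close>.\<close>

lemma norm_x_le_R_level:
  assumes bounded_levels: "\<And>j \<alpha>. bounded (level_set (f j) \<alpha>)" and xb: "A *v xb = b" and "0 \<le> t"
  shows "norm (x t) \<le> R_level f (alpha0 A b f L \<theta>0 \<gamma>0 x0 v0 \<xi>0 xb)" (is "_ \<le> R_level f ?\<alpha>")
proof -
  let ?C = "C0 A b f L \<theta>0 \<gamma>0 x0 v0 \<xi>0 (norm xb) 0"
  obtain j where j: "f j (x t) - f j xb = Min (range (\<lambda>j. f j (x t) - f j xb))"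
    using Min_range_in[of "\<lambda>j. f j (x t) - f j xb"] .
  have "0 \<le> ?C" by (intro C0_nonneg) auto
  have "exp t * (f j (x t) - f j xb) \<le> ?C"
    using lyapunov_decay[OF xb assms(3), of 0] j by simp
  then have "f j (x t) - f j xb \<le> ?C / exp t"
    by (simp add: field_simps)
  also have "\<dots> \<le> ?C / 1"
    using \<open>0 \<le> ?C\<close> assms(3) by (intro divide_left_mono) auto
  finally have 1: "f j (x t) - f j xb \<le> ?C" by simp
  have "0 \<le> L * (norm x0)\<^sup>2" using L_nonneg by simp
  then have 2: "f j xb - f j x0 \<le> C1 f L x0 (norm xb)"
    using f_diff_le[of j xb x0] by (simp add: C1_def algebra_simps power2_eq_square)
  have 3: "f j x0 \<le> Max (range (\<lambda>j. \<bar>f j x0\<bar>))"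
    by (rule order_trans[OF abs_ge_self]) simp
  have "x t \<in> level_set (f j) ?\<alpha>"
    using 1 2 3 unfolding level_set_def alpha0_def by simp
  then have "norm (x t) \<le> Sup (norm ` level_set (f j) ?\<alpha>)"
    using bounded_levels[of j ?\<alpha>] by (intro cSup_upper) (auto simp: bounded_iff bdd_above_def)
  also have "\<dots> \<le> R_level f ?\<alpha>" unfolding R_level_def by simp
  finally show ?thesis .
qed

lemma feasibility_decay:
  assumes "A \<noteq> 0" and bounded_levels: "\<And>j \<alpha>. bounded (level_set (f j) \<alpha>)"
    and xb: "A *v xb = b" and "0 \<le> t"
  shows "norm (A *v x t - b) \<le> exp (- t) * C0 A b f L \<theta>0 \<gamma>0 x0 v0 \<xi>0
    (alpha1 A b f L \<theta>0 \<gamma>0 x0 v0 \<xi>0 xb) (1 + alpha2 A b f L \<theta>0 \<gamma>0 x0 v0 \<xi>0 xb)"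
proof -
  let ?C = "C0 A b f L \<theta>0 \<gamma>0 x0 v0 \<xi>0"
  let ?\<alpha>1 = "alpha1 A b f L \<theta>0 \<gamma>0 x0 v0 \<xi>0 xb"
  let ?\<alpha>2 = "alpha2 A b f L \<theta>0 \<gamma>0 x0 v0 \<xi>0 xb"
  define \<sigma> where "\<sigma> = sigma_min_pos A"
  define R where "R = R_level f (alpha0 A b f L \<theta>0 \<gamma>0 x0 v0 \<xi>0 xb)"
  define d where "d = A *v x t - b"
  have "\<sigma> > 0" using sigma_min_pos_properties[OF \<open>A \<noteq> 0\<close>] by (simp add: \<sigma>_def)
  obtain q where q: "A *v q = b" "\<sigma> * norm (x t - q) \<le> norm d"
    using affine_projection[OF \<open>A \<noteq> 0\<close> xb] unfolding \<sigma>_def d_def .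
  then have xq: "norm (x t - q) \<le> norm d / \<sigma>"
    using \<open>\<sigma> > 0\<close> by (simp add: field_simps)
  have R: "norm (x t) \<le> R" unfolding R_def by (rule norm_x_le_R_level[OF bounded_levels xb \<open>0 \<le> t\<close>])
  \<comment> \<open>This is where \<open>alpha1\<close> comes from: \<open>norm (x t)\<close> is at
    most \<open>R\<close>, and the distance to \<open>q\<close> is at most
    \<open>norm d / \<sigma>\<close>, where \<open>norm d\<close> is estimated by the operator norm,
    \<open>R\<close> and \<open>norm b\<close>.\<close>
  have \<alpha>1: "norm q \<le> ?\<alpha>1"
  proof -
    have "norm (A *v x t) \<le> onorm ((*v) A) * norm (x t)"
      by (rule onorm[OF matrix_vector_mul_bounded_linear])
    also have "\<dots> \<le> onorm ((*v) A) * R"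
      using R by (intro mult_left_mono onorm_pos_le matrix_vector_mul_bounded_linear)
    finally have "norm d \<le> onorm ((*v) A) * R + norm b"
      using norm_triangle_ineq4[of "A *v x t" b] by (simp add: d_def)
    then have "norm d / \<sigma> \<le> (onorm ((*v) A) * R + norm b) / \<sigma>"
      using \<open>\<sigma> > 0\<close> by (simp add: divide_right_mono)
    moreover have "norm q \<le> norm (x t) + norm (x t - q)"
      by (metis norm_triangle_sub norm_minus_commute add.commute)
    ultimately have "norm q \<le> R + (onorm ((*v) A) * R + norm b) / \<sigma>" using R xq by linarith
    also have "\<dots> = ?\<alpha>1"
      by (simp add: alpha1_def R_def \<sigma>_def distrib_right add_divide_distrib)
    finally show ?thesis .
  qed
  then have \<alpha>1_nonneg: "0 \<le> ?\<alpha>1" using norm_ge_zero order_trans by blast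
  then have \<alpha>2_nonneg: "0 \<le> ?\<alpha>2"
    using L_nonneg max_grad0_nonneg \<open>\<sigma> > 0\<close> by (simp add: alpha2_def \<sigma>_def)
  show ?thesis
  \<comment> \<open>The multiplier below is normalized by \<open>norm d\<close>, so a vanishing
    residual is treated apart.\<close>
  proof (cases "d = 0")
    case True
    then show ?thesis using C0_nonneg[OF \<alpha>1_nonneg, of "1 + ?\<alpha>2"] \<alpha>2_nonneg by (simp add: d_def)
  next
    case False
    obtain j where j: "f j (x t) - f j q = Min (range (\<lambda>j. f j (x t) - f j q))"
      using Min_range_in[of "\<lambda>j. f j (x t) - f j q"] .
    \<comment> \<open>By convexity \<open>\<beta>\<close> is a lower bound for the smallest gap,
      possibly negative. The multiplier along \<open>d\<close> is scaled so that its pairing with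
      \<open>d\<close> removes \<open>\<beta>\<close> and leaves exactly
      \<open>norm d\<close>.\<close>
    define \<beta> where "\<beta> = grad (f j) q \<bullet> (x t - q)"
    define \<zeta> where "\<zeta> = ((norm d - \<beta>) / (norm d)\<^sup>2) *\<^sub>R d"
    have \<zeta>: "\<zeta> \<bullet> d = norm d - \<beta>"
      using False by (simp add: \<zeta>_def power2_norm_eq_inner)
    have "\<bar>\<beta>\<bar> \<le> norm (grad (f j) q) * norm (x t - q)" unfolding \<beta>_def by (rule Cauchy_Schwarz_ineq2)
    also have "\<dots> \<le> (max_grad0 f + L * ?\<alpha>1) * (norm d / \<sigma>)"
      using norm_grad_le[of j q] mult_left_mono[OF \<alpha>1 L_nonneg] xq max_grad0_nonneg L_nonneg \<alpha>1_nonneg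
      by (intro mult_mono) auto
    also have "\<dots> = ?\<alpha>2 * norm d" by (simp add: alpha2_def \<sigma>_def add.commute)
    finally have "\<bar>\<beta>\<bar> \<le> ?\<alpha>2 * norm d" .
    \<comment> \<open>The summand 1 in \<open>1 + alpha2\<close> pays for \<open>norm d\<close>
      itself, and \<open>alpha2\<close> pays for \<open>\<beta>\<close>.\<close>
    then have "\<bar>norm d - \<beta>\<bar> \<le> (1 + ?\<alpha>2) * norm d"
      using norm_ge_zero[of d] unfolding distrib_right by linarith
    moreover have "norm \<zeta> = \<bar>norm d - \<beta>\<bar> / norm d"
      using False by (simp add: \<zeta>_def power2_eq_square)
    ultimately have norm_\<zeta>: "norm \<zeta> \<le> 1 + ?\<alpha>2"
      using False by (simp add: divide_le_eq)
    have "norm d \<le> Min (range (\<lambda>j. f j (x t) - f j q)) + \<zeta> \<bullet> d"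
      using f_ge_linear[of j q "x t"] \<zeta> by (simp add: j[symmetric] \<beta>_def)
    then have "exp t * norm d \<le> exp t * (Min (range (\<lambda>j. f j (x t) - f j q)) + \<zeta> \<bullet> d)"
      by simp
    also have "\<dots> \<le> ?C (norm q) (norm \<zeta>)"
      unfolding d_def by (rule lyapunov_decay[OF q(1) \<open>0 \<le> t\<close>])
    also have "\<dots> \<le> ?C ?\<alpha>1 (1 + ?\<alpha>2)" by (intro C0_mono \<alpha>1 norm_\<zeta> norm_ge_zero)
    finally have "norm d \<le> ?C ?\<alpha>1 (1 + ?\<alpha>2) / exp t"
      by (simp add: pos_le_divide_eq mult.commute)
    then show ?thesis by (simp add: d_def exp_minus divide_inverse_commute)
  qed
qed

end

theorem theorem4p1:
  fixes A :: "real ^ 'n ^ 'r" and b :: "real ^ 'r"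
    and f :: "'m::finite \<Rightarrow> real ^ 'n \<Rightarrow> real"
    and \<mu>s Ls :: "'m \<Rightarrow> real" and \<mu> L :: real
    and \<theta> \<gamma> :: "real \<Rightarrow> real" and \<theta>0 \<gamma>0 :: real
    and x v :: "real \<Rightarrow> real ^ 'n" and \<xi> :: "real \<Rightarrow> real ^ 'r"
    and x0 v0 xb :: "real ^ 'n" and \<xi>0 :: "real ^ 'r"
  assumes "A \<noteq> 0"
    and "{x. A *v x = b} \<noteq> {}"
    and "\<And>j. 0 \<le> \<mu>s j \<and> \<mu>s j \<le> Ls j"
    and "\<And>j. C1_fun (f j)"
    and "\<And>j. (Ls j)-lipschitz_on UNIV (grad (f j))"
    and "\<And>j x y. f j y - f j x - grad (f j) x \<bullet> (y - x) \<ge> \<mu>s j / 2 * (norm (x - y))\<^sup>2"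
    and "\<mu> = Min (range \<mu>s)" and "L = Max (range Ls)"
    and "\<And>j \<alpha>. bounded (level_set (f j) \<alpha>)"
    and "\<theta>0 > 0" and "\<gamma>0 > 0"
    and "\<theta> 0 = \<theta>0"
    and "\<And>t. t \<ge> 0 \<Longrightarrow> (\<theta> has_real_derivative - \<theta> t) (at t within {0..})"
    and "\<gamma> 0 = \<gamma>0"
    and "\<And>t. t \<ge> 0 \<Longrightarrow> (\<gamma> has_real_derivative \<mu> - \<gamma> t) (at t within {0..})"
    and "ampd_di_solution A b f \<mu> \<theta> \<gamma> x0 v0 \<xi>0 x v \<xi>"
    and "xb \<in> {x. A *v x = b}"
  shows "\<forall>t>0. norm (A *v x t - b) \<le>
    exp (- t) * C0 A b f L \<theta>0 \<gamma>0 x0 v0 \<xi>0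
      (alpha1 A b f L \<theta>0 \<gamma>0 x0 v0 \<xi>0 xb) (1 + alpha2 A b f L \<theta>0 \<gamma>0 x0 v0 \<xi>0 xb)"
proof -
  interpret ampd_di A b f \<mu>s Ls \<mu> L \<theta> \<gamma> \<theta>0 \<gamma>0 x v \<xi> x0 v0 \<xi>0
    by unfold_locales (fact assms)+
  show ?thesis
    using feasibility_decay[OF assms(1,9)] assms(17) by simp
qed

end
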